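(* Let $H$ be a Hilbert space, $U\in\mathcal{L}(H)$ a unitary operator, $r,k\in\mathbb{N}^+$, $p_1,\ldots,p_r\in\mathcal{P}$, and let $\alpha:\{1,\ldots,k\}\to\{1,\ldots,r\}$ be a surjective mapping. Let further $A_1,\ldots,A_k\in\mathcal{L}(H)$ be such that $\{A_kU^{-n}: n\in\mathbb{N}^+\}$ is relatively compact in $\mathcal{L}(H)$ for the strong operator topology, and $\{A_jU^n: n\in\mathbb{N}^+\}$ is relatively compact in $\mathcal{L}(H)$ for the strong operator topology for every $1\le j\le k-1$. Then the polynomial entangled ergodic averages \[ \frac{1}{N^r}\sum_{n_1,\ldots,n_r=1}^{N} U^{p_{\alpha(1)}(n_{\alpha(1)})}A_1U^{p_{\alpha(2)}(n_{\alpha(2)})}A_2\cdots U^{p_{\alpha(k)}(n_{\alpha(k)})} A_k U^{-\sum_{j=1}^k p_{\alpha(j)}(n_{\alpha(j)})} \] converge in the strong operator topology as $N\to\infty$.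
   Context: $\mathbb{N}^+$ denotes the positive integers and $\mathbb{N}_0$ the nonnegative integers. $\mathcal{P}\subset\mathbb{Z}[X]$ is the set of all polynomials with integer coefficients mapping $\mathbb{N}^+$ into $\mathbb{N}_0$. $\mathcal{L}(H)$ is the space of bounded linear operators on $H$. *)

theory Defs
  imports "HOL-Analysis.Analysis" "HOL-Computational_Algebra.Polynomial"
begin

text \<open>
  A complex inner product space is given together with its underlying real inner product
  space, whose inner product is the real part of the complex one; the axioms
  \<open>scaleR_eq_scaleC\<close> and \<open>inner_eq_Re_cinner\<close> tie the two structures together, so that norm
  and topology are those of \<open>cinner\<close>. The complex inner product is linear in its first argument.
\<close>

class complex_inner = real_inner +
  fixes scaleC :: "complex \<Rightarrow> 'a \<Rightarrow> 'a" (infixr "*\<^sub>C" 75)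
    and cinner :: "'a \<Rightarrow> 'a \<Rightarrow> complex"
  assumes scaleC_add_right: "scaleC a (x + y) = scaleC a x + scaleC a y"
    and scaleC_add_left: "scaleC (a + b) x = scaleC a x + scaleC b x"
    and scaleC_scaleC: "scaleC a (scaleC b x) = scaleC (a * b) x"
    and scaleR_eq_scaleC: "scaleR r x = scaleC (complex_of_real r) x"
    and cinner_commute: "cinner x y = cnj (cinner y x)"
    and cinner_add_left: "cinner (x + y) z = cinner x z + cinner y z"
    and cinner_scaleC_left: "cinner (scaleC a x) y = a * cinner x y"
    and inner_eq_Re_cinner: "inner x y = Re (cinner x y)"

class chilbert_space = complex_inner + complete_space

lemma norm_eq_sqrt_cinner: "norm x = sqrt (Re (cinner x x))"
  by (simp add: norm_eq_sqrt_inner inner_eq_Re_cinner)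

lemma cinner_self: "cinner x x = complex_of_real ((norm x)\<^sup>2)"
proof -
  have "Im (cinner x x) = 0"
    using arg_cong[OF cinner_commute[of x x], of Im] by simp
  then show ?thesis
    by (simp add: complex_eq_iff power2_norm_eq_inner inner_eq_Re_cinner)
qed

instantiation complex :: chilbert_space
begin

definition scaleC_complex :: "complex \<Rightarrow> complex \<Rightarrow> complex"
  where "scaleC_complex a x = a * x"

definition cinner_complex :: "complex \<Rightarrow> complex \<Rightarrow> complex"
  where "cinner_complex x y = x * cnj y"

instance
  by standard
    (auto simp: scaleC_complex_def cinner_complex_def inner_complex_def algebra_simps scaleR_conv_of_real)

end

text \<open>
  Elements of the type \<open>'a \<Rightarrow>\<^sub>L 'a\<close> are bounded and only real-linear; \<open>bounded_cops\<close> is the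
  space of bounded complex-linear operators.
\<close>

definition bounded_cops :: "('a::complex_inner \<Rightarrow>\<^sub>L 'a) set"
  where "bounded_cops = {T. \<forall>c x. blinfun_apply T (c *\<^sub>C x) = c *\<^sub>C blinfun_apply T x}"

definition sot :: "('a::complex_inner \<Rightarrow>\<^sub>L 'a) topology"
  where "sot = subtopology strong_operator_topology bounded_cops"

lemma topspace_sot: "topspace sot = bounded_cops"
  by (simp add: sot_def strong_operator_topology_topspace)

definition relatively_compactin :: "'b topology \<Rightarrow> 'b set \<Rightarrow> bool"
  where "relatively_compactin X S \<longleftrightarrow> S \<subseteq> topspace X \<and> compactin X (X closure_of S)"

definition is_adjoint :: "('a::complex_inner \<Rightarrow>\<^sub>L 'a) \<Rightarrow> ('a \<Rightarrow>\<^sub>L 'a) \<Rightarrow> bool"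
  where "is_adjoint T V \<longleftrightarrow>
    (\<forall>x y. cinner (blinfun_apply T x) y = cinner x (blinfun_apply V y))"

definition unitary_op :: "('a::complex_inner \<Rightarrow>\<^sub>L 'a) \<Rightarrow> bool"
  where "unitary_op U \<longleftrightarrow> U \<in> bounded_cops \<and>
    (\<exists>V\<in>bounded_cops. is_adjoint U V \<and> U o\<^sub>L V = id_blinfun \<and> V o\<^sub>L U = id_blinfun)"

definition op_inverse :: "('a::real_normed_vector \<Rightarrow>\<^sub>L 'a) \<Rightarrow> ('a \<Rightarrow>\<^sub>L 'a)"
  where "op_inverse T = (THE V. T o\<^sub>L V = id_blinfun \<and> V o\<^sub>L T = id_blinfun)"

lemma op_inverse_eq:
  assumes "T o\<^sub>L V = id_blinfun" "V o\<^sub>L T = id_blinfun"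
  shows "op_inverse T = V"
  unfolding op_inverse_def
proof (rule the_equality)
  fix W assume W: "T o\<^sub>L W = id_blinfun \<and> W o\<^sub>L T = id_blinfun"
  show "W = V"
  proof (rule blinfun_eqI)
    fix x
    have "blinfun_apply T (blinfun_apply V x) = x"
      using assms(1) by (metis blinfun_apply_blinfun_compose blinfun_apply_id_blinfun id_apply)
    moreover have "blinfun_apply W (blinfun_apply T (blinfun_apply V x)) = blinfun_apply V x"
      using W by (metis blinfun_apply_blinfun_compose blinfun_apply_id_blinfun id_apply)
    ultimately show "blinfun_apply W x = blinfun_apply V x" by simp
  qed
qed (use assms in auto)

primrec op_pow :: "('a::real_normed_vector \<Rightarrow>\<^sub>L 'a) \<Rightarrow> nat \<Rightarrow> ('a \<Rightarrow>\<^sub>L 'a)"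
  where "op_pow T 0 = id_blinfun"
  | "op_pow T (Suc n) = T o\<^sub>L op_pow T n"

definition op_powi :: "('a::real_normed_vector \<Rightarrow>\<^sub>L 'a) \<Rightarrow> int \<Rightarrow> ('a \<Rightarrow>\<^sub>L 'a)"
  where "op_powi T m = (if m \<ge> 0 then op_pow T (nat m) else op_pow (op_inverse T) (nat (- m)))"

text \<open>The ordered product \<open>B 1 \<circ> B 2 \<circ> \<dots> \<circ> B k\<close>.\<close>

primrec op_prod :: "(nat \<Rightarrow> ('a::real_normed_vector \<Rightarrow>\<^sub>L 'a)) \<Rightarrow> nat \<Rightarrow> ('a \<Rightarrow>\<^sub>L 'a)"
  where "op_prod B 0 = id_blinfun"
  | "op_prod B (Suc k) = op_prod B k o\<^sub>L B (Suc k)"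

definition nat_valued_polys :: "int poly set"
  where "nat_valued_polys = {p. \<forall>n::nat. n \<ge> 1 \<longrightarrow> poly p (int n) \<ge> 0}"

text \<open>
  The indices \<open>(n\<^sub>1, \<dots>, n\<^sub>r)\<close> range over the functions \<open>{1..r} \<rightarrow> {1..N}\<close>, made
  unique by extensionality outside \<open>{1..r}\<close>.
\<close>

definition entangled_average ::
  "('a::real_normed_vector \<Rightarrow>\<^sub>L 'a) \<Rightarrow> nat \<Rightarrow> nat \<Rightarrow> (nat \<Rightarrow> int poly) \<Rightarrow> (nat \<Rightarrow> nat) \<Rightarrow>
    (nat \<Rightarrow> ('a \<Rightarrow>\<^sub>L 'a)) \<Rightarrow> nat \<Rightarrow> ('a \<Rightarrow>\<^sub>L 'a)"
  where "entangled_average U r k p \<alpha> A N =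
    (1 / real N ^ r) *\<^sub>R
      (\<Sum>n \<in> {1..r} \<rightarrow>\<^sub>E {1..N}.
        op_prod (\<lambda>j. op_powi U (poly (p (\<alpha> j)) (int (n (\<alpha> j)))) o\<^sub>L A j) k
        o\<^sub>L op_powi U (- (\<Sum>j=1..k. poly (p (\<alpha> j)) (int (n (\<alpha> j))))))"

end

theory Submission
  imports Defs "HOL-Probability.Probability" "HOL-Real_Asymp.Real_Asymp"
begin

text \<open>
  By relative compactness and Gram-Schmidt, the vectors \<open>A\<^sub>k U\<^bsup>-s\<^esup> x\<close> and
  \<open>A\<^sub>j U\<^bsup>q\<^esup> y\<close> are, uniformly in the exponents, close to finite sums of fixed vectors whose
  coefficients are matrix coefficients of powers of \<open>U\<close>. Working through the product from right to
  left reduces the claim to the averages of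
  \<open>\<phi>(n) U\<^bsup>p(n)\<^esup> y\<close>, where \<open>\<phi>\<close> is a product of such matrix coefficients.
  Herglotz' theorem realises \<open>m \<mapsto> U\<^bsup>m\<^esup> y\<close> isometrically as \<open>m \<mapsto> e\<^bsup>im\<theta>\<^esup>\<close> in some
  \<open>L\<^sup>2(\<mu>)\<close>, so by dominated convergence these averages converge as soon as all the scalar averages of
  \<open>\<phi>(n) e\<^bsup>i\<theta>p(n)\<^esup>\<close> do. Applying this repeatedly strips the factors off \<open>\<phi>\<close> one at a
  time and leaves products of one-variable Weyl sums.
\<close>

section \<open>Weyl sums of integer polynomials\<close>

text \<open>Several factors of the product may share one variable, and the last exponent mixes all
  of them, so the average does not split into one-variable averages. Scalars are therefore tested
  against phases with \<open>r\<close> independent frequencies, and splitting over coordinates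
  happens only once the scalar is constant. For \<open>j < k\<close> the power of \<open>U\<close>
  to the right of \<open>A j\<close> is a value of one polynomial, while \<open>A k\<close> meets
  minus a sum of such values; nonnegativity of the polynomials decides which orbit hypothesis
  applies. Relative compactness enters through norm compact sets containing the orbits of single
  vectors, and every approximation is uniform in the indices, so that it survives averaging. The
  limits of the vector averages are not identified: the spectral isometry computes norms of
  differences of averages, so it is the Cauchy property that is proved.\<close>

lemma norm_sum_shift_diff_le:
  fixes u :: "nat \<Rightarrow> complex"
  assumes "\<And>n. norm (u n) \<le> 1"
  shows "norm ((\<Sum>n<N. u (n + h)) - (\<Sum>n<N. u n)) \<le> 2 * real h"
proof (induction h)
  case (Suc h)
  have "(\<Sum>n<N. u (n + Suc h)) - (\<Sum>n<N. u (n + h)) = u (N + h) - u h"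
    using sum_lessThan_telescope[of "\<lambda>n. u (n + h)" N] by (simp add: sum_subtractf)
  moreover have "norm (u (N + h) - u h) \<le> 2"
    using norm_triangle_ineq4[of "u (N + h)" "u h"] assms[of "N + h"] assms[of h] by linarith
  ultimately have "norm ((\<Sum>n<N. u (n + Suc h)) - (\<Sum>n<N. u (n + h))) \<le> 2" by simp
  from norm_triangle_le[OF add_mono[OF this Suc]] show ?case by simp
qed simp

lemma tendsto_mean_shift:
  fixes u :: "nat \<Rightarrow> complex"
  assumes "\<And>n. norm (u n) \<le> 1" and lim: "(\<lambda>N. (\<Sum>n<N. u n) / of_nat N) \<longlonglongrightarrow> 0"
  shows "(\<lambda>N. (\<Sum>n<N. u (n + h)) / of_nat N) \<longlonglongrightarrow> 0"
proof -
  have "(\<lambda>N. 2 * real h / real N) \<longlonglongrightarrow> 0"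
    by (rule lim_const_over_n)
  then have "(\<lambda>N. ((\<Sum>n<N. u (n + h)) - (\<Sum>n<N. u n)) / of_nat N) \<longlonglongrightarrow> 0"
    by (rule Lim_null_comparison[rotated])
       (auto simp: norm_divide intro!: always_eventually divide_right_mono norm_sum_shift_diff_le assms)
  from tendsto_add[OF this lim] show ?thesis
    by (simp add: diff_divide_distrib)
qed

lemma norm_mean_sq_le:
  fixes v :: "nat \<Rightarrow> complex"
  shows "(norm ((\<Sum>n<N. v n) / of_nat N))\<^sup>2 \<le> (\<Sum>n<N. (norm (v n))\<^sup>2) / real N"
proof (cases "N = 0")
  case False
  have "(norm (\<Sum>n<N. v n))\<^sup>2 \<le> (\<Sum>n<N. norm (v n))\<^sup>2"
    by (intro power_mono norm_sum) auto
  also have "\<dots> \<le> real N * (\<Sum>n<N. (norm (v n))\<^sup>2)"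
    using sum_squared_le_sum_of_squares[of "\<lambda>n. norm (v n)" "{..<N}"] by (simp add: mult.commute)
  finally show ?thesis
    using False by (simp add: norm_divide power_divide field_simps power2_eq_square)
qed simp

text \<open>Up to a boundary term the mean is a mean of sliding averages of length \<open>H\<close>; in their second
  moment only the diagonal, of size \<open>1/H\<close>, survives.\<close>

lemma van_der_Corput:
  fixes u :: "nat \<Rightarrow> complex"
  assumes bd: "\<And>n. norm (u n) \<le> 1"
    and corr: "\<And>h. h \<ge> 1 \<Longrightarrow> (\<lambda>N. (\<Sum>n<N. u (n + h) * cnj (u n)) / of_nat N) \<longlonglongrightarrow> 0"
  shows "(\<lambda>N. (\<Sum>n<N. u n) / of_nat N) \<longlonglongrightarrow> 0"
proof (rule tendstoI)
  fix e :: real assume e: "e > 0"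
  \<comment> \<open>The summand of \<open>c h h'\<close> is a shift by \<open>h'\<close> of the
    correlation at distance \<open>h - h'\<close>. Thus \<open>corr\<close> covers
    \<open>h' < h\<close>, and conjugation covers the opposite order.\<close>
  define c where "c h h' N = (\<Sum>n<N. u (n + h) * cnj (u (n + h'))) / of_nat N" for h h' N
  have uu: "norm (u a * cnj (u b)) \<le> 1" for a b
    using bd[of a] bd[of b] by (simp add: norm_mult mult_le_one)
  have c_gt: "c h h' \<longlonglongrightarrow> 0" if "h' < h" for h h'
  proof -
    have "(\<lambda>N. (\<Sum>n<N. u (n + h' + (h - h')) * cnj (u (n + h'))) / of_nat N) \<longlonglongrightarrow> 0"
      using that
      by (intro tendsto_mean_shift[where u = "\<lambda>n. u (n + (h - h')) * cnj (u n)"] corr uu) auto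
    moreover have "n + h' + (h - h') = n + h" for n using that by simp
    ultimately show ?thesis by (simp add: c_def[abs_def])
  qed
  have c_cnj: "c h h' N = cnj (c h' h N)" for h h' N
    by (simp add: c_def mult.commute)
  have c_ne: "c h h' \<longlonglongrightarrow> 0" if "h' \<noteq> h" for h h'
  proof (cases "h' < h")
    case False
    with that have "h < h'" by simp
    from tendsto_cnj[OF c_gt[OF this]] show ?thesis
      by (simp add: c_cnj[of h h', abs_def] )
  qed (rule c_gt)
  have c_le: "norm (c h h' N) \<le> 1" for h h' N
  proof (cases "N = 0")
    case False
    have "norm (\<Sum>n<N. u (n + h) * cnj (u (n + h'))) \<le> (\<Sum>n<N. 1)"
      by (rule sum_norm_le) (rule uu)
    with False show ?thesis by (simp add: c_def norm_divide)
  qed (simp add: c_def)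
  define off where "off H N = (\<Sum>h<H. \<Sum>h'<H. if h = h' then 0 else norm (c h h' N))" for H :: nat and N
  have off: "off H \<longlonglongrightarrow> 0" for H
    unfolding off_def[abs_def]
  proof (intro tendsto_null_sum)
    fix h h' show "(\<lambda>N. if h = h' then 0 else norm (c h h' N)) \<longlonglongrightarrow> 0"
      by (cases "h = h'") (auto intro: tendsto_norm_zero c_ne)
  qed
  have bound: "norm ((\<Sum>n<N. u n) / of_nat N)
      \<le> 2 * real H / real N + sqrt (1 / real H + off H N / (real H)\<^sup>2)" if H: "H \<ge> 1" for H N
  proof -
    define T where "T = (\<Sum>n<N. (\<Sum>h<H. u (n + h)) / of_nat H) / of_nat N"
    have "(\<Sum>n<N. u n) / of_nat N - T
        = (\<Sum>h<H. (\<Sum>n<N. u n) - (\<Sum>n<N. u (n + h))) / of_nat H / of_nat N"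
      unfolding T_def using H
      by (subst sum_divide_distrib[symmetric], subst sum.swap)
         (simp add: sum_subtractf diff_divide_distrib)
    moreover have "norm (\<Sum>h<H. (\<Sum>n<N. u n) - (\<Sum>n<N. u (n + h))) / real H / real N
        \<le> (\<Sum>h<H. 2 * real H) / real H / real N"
    proof (intro divide_right_mono)
      show "norm (\<Sum>h<H. (\<Sum>n<N. u n) - (\<Sum>n<N. u (n + h))) \<le> (\<Sum>h<H. 2 * real H)"
      proof (rule sum_norm_le)
        fix h assume "h \<in> {..<H}"
        then show "norm ((\<Sum>n<N. u n) - (\<Sum>n<N. u (n + h))) \<le> 2 * real H"
          using norm_sum_shift_diff_le[of u h N] bd by (simp add: norm_minus_commute)
      qed
    qed auto
    ultimately have 1: "norm ((\<Sum>n<N. u n) / of_nat N - T) \<le> 2 * real H / real N"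
      using H by (simp add: norm_divide norm_mult)
    define Q where "Q = (\<Sum>n<N. (norm ((\<Sum>h<H. u (n + h)) / of_nat H))\<^sup>2) / real N"
    have "complex_of_real Q = (\<Sum>h<H. \<Sum>h'<H. c h h' N) / (of_nat H)\<^sup>2"
    proof -
      have "complex_of_real ((norm ((\<Sum>h<H. u (n + h)) / of_nat H))\<^sup>2)
          = (\<Sum>h<H. \<Sum>h'<H. u (n + h) * cnj (u (n + h'))) / (of_nat H)\<^sup>2" for n
        by (subst complex_norm_square) (simp add: sum_product power2_eq_square)
      then have "complex_of_real Q
          = (\<Sum>n<N. \<Sum>h<H. \<Sum>h'<H. u (n + h) * cnj (u (n + h'))) / (of_nat H)\<^sup>2 / of_nat N"
        by (simp add: Q_def sum_divide_distrib)
      also have "(\<Sum>n<N. \<Sum>h<H. \<Sum>h'<H. u (n + h) * cnj (u (n + h')))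
          = (\<Sum>h<H. \<Sum>h'<H. \<Sum>n<N. u (n + h) * cnj (u (n + h')))"
        by (simp only: sum.swap[of _ "{..<H}" "{..<N}"])
      finally show ?thesis by (simp add: c_def sum_divide_distrib mult.commute)
    qed
    then have "norm Q = norm (\<Sum>h<H. \<Sum>h'<H. c h h' N) / (real H)\<^sup>2"
      by (metis norm_divide norm_of_real norm_of_nat norm_power real_norm_def)
    moreover have "norm (\<Sum>h<H. \<Sum>h'<H. c h h' N)
        \<le> (\<Sum>h<H. \<Sum>h'<H. (if h = h' then 1 else 0) + (if h = h' then 0 else norm (c h h' N)))"
      by (intro sum_norm_le) (simp add: c_le)
    moreover have "(\<Sum>h<H. \<Sum>h'<H. (if h = h' then 1 else 0) + (if h = h' then 0 else norm (c h h' N)))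
        = real H + off H N"
      by (simp add: off_def sum.distrib)
    ultimately have "Q \<le> (real H + off H N) / (real H)\<^sup>2"
      by (smt (verit) divide_right_mono real_norm_def zero_le_power2)
    also have "\<dots> = 1 / real H + off H N / (real H)\<^sup>2"
      using H by (simp add: add_divide_distrib power2_eq_square)
    finally have "(norm T)\<^sup>2 \<le> 1 / real H + off H N / (real H)\<^sup>2"
      using norm_mean_sq_le[of "\<lambda>n. (\<Sum>h<H. u (n + h)) / of_nat H" N] by (simp add: T_def Q_def)
    then have "norm T \<le> sqrt (1 / real H + off H N / (real H)\<^sup>2)"
      using real_le_rsqrt by blast
    with 1 show ?thesis
      using norm_triangle_ineq[of "(\<Sum>n<N. u n) / of_nat N - T" T] by simp
  qed
  \<comment> \<open>\<open>H\<close> is fixed first, to make the diagonal contribution small. The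
    boundary and off-diagonal terms then vanish as \<open>N\<close> grows, since for fixed
    \<open>H\<close> there are finitely many of them.\<close>
  obtain H :: nat where H: "H \<ge> 1" "sqrt (1 / real H) < e"
  proof -
    have "(\<lambda>H. sqrt (1 / real H)) \<longlonglongrightarrow> 0"
      using tendsto_real_sqrt[OF lim_const_over_n[of 1]] by simp
    then have "\<forall>\<^sub>F H in sequentially. H \<ge> 1 \<and> sqrt (1 / real H) < e"
      using e by (intro eventually_conj eventually_ge_at_top order_tendstoD)
    then show ?thesis using that eventually_happens'[OF sequentially_bot] by fast
  qed
  have "(\<lambda>N. 2 * real H / real N) \<longlonglongrightarrow> 0"
    by (rule lim_const_over_n)
  then have "(\<lambda>N. 2 * real H / real N + sqrt (1 / real H + off H N / (real H)\<^sup>2))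
      \<longlonglongrightarrow> 0 + sqrt (1 / real H + 0 / (real H)\<^sup>2)"
    by (intro tendsto_add tendsto_real_sqrt tendsto_const tendsto_divide off) (use H(1) in auto)
  then have "\<forall>\<^sub>F N in sequentially. 2 * real H / real N + sqrt (1 / real H + off H N / (real H)\<^sup>2) < e"
    using H(2) by (intro order_tendstoD) auto
  then show "\<forall>\<^sub>F N in sequentially. dist ((\<Sum>n<N. u n) / of_nat N) 0 < e"
    using bound[OF H(1)] by (auto elim!: eventually_mono intro: le_less_trans)
qed

section \<open>Resonant and nonresonant Weyl sums\<close>

lemma convergent_mean_periodic:
  fixes u :: "nat \<Rightarrow> complex"
  assumes b: "b \<ge> 1" and per: "\<And>n. u (n + b) = u n"
  shows "convergent (\<lambda>N. (\<Sum>n<N. u n) / of_nat N)"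
proof -
  define c where "c = (\<Sum>n<b. u n) / of_nat b"
  \<comment> \<open>As \<open>c\<close> is the mean over one period, the deviation of the partial
    sums from linear growth is itself periodic. Being bounded, it disappears after division by
    \<open>N\<close>.\<close>
  define D where "D N = (\<Sum>n<N. u n) - of_nat N * c" for N
  have per_sum: "(\<Sum>n<N + b. u n) = (\<Sum>n<N. u n) + of_nat b * c" for N
  proof (induction N)
    case 0
    then show ?case using b by (simp add: c_def)
  next
    case (Suc N)
    then show ?case using per[of N] by (simp add: algebra_simps)
  qed
  have "D (N + b) = D N" for N
    by (simp add: D_def per_sum algebra_simps)
  then have "D (m + b * q) = D m" for m q
    by (induction q) (simp_all add: add.commute[of b] flip: add.assoc)
  then have "D N = D (N mod b)" for N
    by (metis mod_mult_div_eq)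
  then have le: "norm (D N) \<le> (\<Sum>m<b. norm (D m))" for N
    using member_le_sum[of "N mod b" "{..<b}" "\<lambda>m. norm (D m)"] b by simp
  have "(\<lambda>N. (\<Sum>m<b. norm (D m)) / real N) \<longlonglongrightarrow> 0"
    by (rule lim_const_over_n)
  then have "(\<lambda>N. D N / of_nat N) \<longlonglongrightarrow> 0"
    by (rule Lim_null_comparison[rotated])
       (auto simp: norm_divide intro!: always_eventually divide_right_mono le)
  from tendsto_add[OF this tendsto_const[of c]] have "(\<lambda>N. D N / of_nat N + c) \<longlonglongrightarrow> c" by simp
  moreover have "\<forall>\<^sub>F N in sequentially. D N / of_nat N + c = (\<Sum>n<N. u n) / of_nat N"
    using eventually_gt_at_top[of 0] by eventually_elim (simp add: D_def field_simps)
  ultimately show ?thesis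
    by (auto simp: convergent_def intro: Lim_transform_eventually)
qed

lemma cis_times_int_eq_1:
  assumes "cis (t * of_int m) = 1" "m dvd j"
  shows "cis (t * of_int j) = 1"
proof -
  obtain q where "j = m * q" using assms(2) by (auto elim: dvdE)
  then show ?thesis
    using assms(1) cis_power_int[of "t * of_int m" q] by (simp add: mult_ac)
qed

lemma dvd_poly_diff:
  fixes p :: "'a::comm_ring_1 poly"
  shows "x - y dvd poly p x - poly p y"
proof (induction p)
  case (pCons a p)
  have "poly (pCons a p) x - poly (pCons a p) y = (x - y) * poly p x + y * (poly p x - poly p y)"
    by (simp add: algebra_simps)
  with pCons show ?case by simp
qed simp

text \<open>The leading terms of \<open>p(X + h)\<close> and \<open>p(X)\<close> cancel, so the
  degree drops. A constant difference would make \<open>p\<close> affine on the multiples of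
  \<open>h\<close>, hence \<open>p(hX)\<close> an affine polynomial, against degree at least 2.
  Positivity of the new degree keeps the differencing induction away from constant phases.\<close>

lemma degree_difference_poly:
  fixes p :: "int poly"
  assumes d: "degree p \<ge> 2" and h: "h \<noteq> 0"
  defines "q \<equiv> pcompose p [:h, 1:] - p"
  shows "0 < degree q" "degree q < degree p"
proof -
  have deg: "degree (pcompose p [:h, 1:]) = degree p"
    by (simp add: degree_pcompose)
  have lc: "lead_coeff (pcompose p [:h, 1:]) = lead_coeff p"
    by (subst lead_coeff_comp) auto
  have le: "degree q \<le> degree p"
    unfolding q_def using degree_diff_le_max[of "pcompose p [:h, 1:]" p] deg by simp
  show "degree q < degree p"
  proof (rule ccontr)
    assume "\<not> ?thesis"
    with le have eq: "degree q = degree p" by simp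
    have "lead_coeff q = 0"
      unfolding eq using lc deg by (simp add: q_def)
    then have "q = 0" by simp
    with eq d show False by simp
  qed
  show "0 < degree q"
  proof (rule ccontr)
    assume "\<not> ?thesis"
    then obtain c where c: "q = [:c:]" by (auto elim: degree_eq_zeroE)
    have step: "poly p (x + h) = poly p x + c" for x
    proof -
      have "poly q x = c" by (simp add: c)
      then show ?thesis by (simp add: q_def poly_pcompose add.commute)
    qed
    have lin: "poly p (h * int m) = poly p 0 + c * int m" for m
    proof (induction m)
      case (Suc m)
      have "h * int (Suc m) = h * int m + h" by (simp add: algebra_simps)
      with step[of "h * int m"] Suc show ?case by (simp add: algebra_simps)
    qed simp
    define w where "w = pcompose p [:0, h:] - [:poly p 0, c:]"
    have "poly w (int m) = 0" for m
      using lin[of m] by (simp add: w_def poly_pcompose mult.commute)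
    then have "range int \<subseteq> {x. poly w x = 0}" by auto
    moreover have "infinite (range int)" by (simp add: finite_image_iff)
    ultimately have "w = 0" using poly_roots_finite finite_subset by blast
    then have "pcompose p [:0, h:] = [:poly p 0, c:]" by (simp add: w_def)
    moreover have "degree (pcompose p [:0, h:]) = degree p"
      using h by (simp add: degree_pcompose)
    ultimately show False using d by (simp split: if_splits)
  qed
qed

text \<open>Weyl differencing: the correlation of the sequence with its shift by \<open>h\<close> is
  the Weyl sum of \<open>p(X + h) - p(X)\<close>, of smaller but positive degree. The induction ends
  at degree one with a geometric series, whose ratio is not 1 by the assumption on
  \<open>t\<close>.\<close>

lemma Weyl_nonresonant:
  fixes p :: "int poly"
  assumes t: "\<And>m::int. m \<noteq> 0 \<Longrightarrow> cis (t * of_int m) \<noteq> 1"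
  shows "degree p \<ge> 1 \<Longrightarrow>
    (\<lambda>N. (\<Sum>n<N. cis (t * of_int (poly p (int n)))) / of_nat N) \<longlonglongrightarrow> 0"
proof (induction "degree p" arbitrary: p rule: less_induct)
  case less
  show ?case
  proof (cases "degree p = 1")
    case True
    then obtain a b where p: "p = [:b, a:]" "a \<noteq> 0"
    proof (cases p rule: pCons_cases)
      case (pCons b q)
      with True have "degree q = 0" "q \<noteq> 0" by (auto split: if_splits)
      with pCons that show ?thesis by (auto elim: degree_eq_zeroE)
    qed
    define z where "z = cis (t * of_int a)"
    have z: "z \<noteq> 1" using t[OF p(2)] by (simp add: z_def)
    have eq: "cis (t * of_int (poly p (int n))) = cis (t * of_int b) * z ^ n" for n
      using Complex.DeMoivre[of "t * of_int a" n] by (simp add: z_def p cis_mult[symmetric] algebra_simps)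
    have "(\<lambda>N. (2 / norm (z - 1)) / real N) \<longlonglongrightarrow> 0" by (rule lim_const_over_n)
    then show ?thesis
    proof (rule Lim_null_comparison[rotated], intro always_eventually allI)
      fix N
      have "norm (z ^ N - 1) \<le> 2"
        using norm_triangle_ineq4[of "z ^ N" 1] by (simp add: z_def norm_power)
      then show "norm ((\<Sum>n<N. cis (t * of_int (poly p (int n)))) / of_nat N)
          \<le> 2 / norm (z - 1) / real N"
        unfolding eq sum_distrib_left[symmetric] using z
        by (simp add: geometric_sum norm_divide norm_mult divide_right_mono)
    qed
  next
    case False
    with less.prems have d: "degree p \<ge> 2" by simp
    show ?thesis
    proof (rule van_der_Corput)
      fix h :: nat assume h: "h \<ge> 1"
      define q where "q = pcompose p [:int h, 1:] - p"
      have q: "0 < degree q" "degree q < degree p"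
        unfolding q_def using h by (intro degree_difference_poly d; simp)+
      have "(\<lambda>N. (\<Sum>n<N. cis (t * of_int (poly q (int n)))) / of_nat N) \<longlonglongrightarrow> 0"
        using q by (intro less.hyps) auto
      moreover have "cis (t * of_int (poly q (int n)))
          = cis (t * of_int (poly p (int (n + h)))) * cnj (cis (t * of_int (poly p (int n))))" for n
        by (simp add: q_def poly_pcompose cis_cnj cis_mult algebra_simps)
      ultimately show "(\<lambda>N. (\<Sum>n<N. cis (t * of_int (poly p (int (n + h)))) *
          cnj (cis (t * of_int (poly p (int n))))) / of_nat N) \<longlonglongrightarrow> 0" by simp
    qed simp
  qed
qed

text \<open>The dichotomy is whether \<open>t / (2 * pi)\<close> is rational. If
  \<open>cis (t * m) = 1\<close> with \<open>m\<close> nonzero, divisibility of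
  \<open>p(x) - p(y)\<close> by \<open>x - y\<close> makes the sequence periodic with period
  \<open>\<bar>m\<bar>\<close>; otherwise the means of a nonconstant \<open>p\<close> tend to
  0.\<close>

lemma Weyl_convergent:
  fixes p :: "int poly"
  shows "convergent (\<lambda>N. (\<Sum>n<N. cis (t * of_int (poly p (int n)))) / of_nat N)"
proof -
  consider (res) m where "m \<noteq> 0" "cis (t * of_int m) = 1" | (const) "degree p = 0"
    | (nonres) "\<And>m::int. m \<noteq> 0 \<Longrightarrow> cis (t * of_int m) \<noteq> 1" "degree p \<ge> 1"
    by (metis One_nat_def Suc_leI bot_nat_0.not_eq_extremum)
  then show ?thesis
  proof cases
    case res
    show ?thesis
    proof (rule convergent_mean_periodic)
      show "nat \<bar>m\<bar> \<ge> 1" using res(1) by simp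
      fix n
      have "m dvd int (n + nat \<bar>m\<bar>) - int n" by simp
      also have "\<dots> dvd poly p (int (n + nat \<bar>m\<bar>)) - poly p (int n)"
        by (rule dvd_poly_diff)
      finally have "cis (t * of_int (poly p (int (n + nat \<bar>m\<bar>)) - poly p (int n))) = 1"
        by (rule cis_times_int_eq_1[OF res(2)])
      then show "cis (t * of_int (poly p (int (n + nat \<bar>m\<bar>)))) = cis (t * of_int (poly p (int n)))"
        by (simp add: right_diff_distrib flip: cis_divide)
    qed
  next
    case const
    then obtain c where "p = [:c:]" by (auto elim: degree_eq_zeroE)
    then show ?thesis by (intro convergent_mean_periodic[of 1]) auto
  next
    case nonres
    then show ?thesis using Weyl_nonresonant convergent_def by blast
  qed
qed

section \<open>Complex inner product spaces\<close>

lemma scaleC_zero_left [simp]: "0 *\<^sub>C (x::'a::complex_inner) = 0"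
  using scaleR_eq_scaleC[of 0 x] by simp

lemma scaleC_zero_right [simp]: "c *\<^sub>C (0::'a::complex_inner) = 0"
  using scaleC_add_right[of c 0 "0::'a"] by simp

lemma scaleC_one [simp]: "1 *\<^sub>C (x::'a::complex_inner) = x"
  using scaleR_eq_scaleC[of 1 x] by simp

lemma scaleC_minus_left: "(- c) *\<^sub>C (x::'a::complex_inner) = - (c *\<^sub>C x)"
  using scaleC_add_left[of "- c" c x] by (simp add: eq_neg_iff_add_eq_0)

lemma scaleC_minus_right: "c *\<^sub>C (- x) = - (c *\<^sub>C (x::'a::complex_inner))"
  using scaleC_add_right[of c "- x" x] by (simp add: eq_neg_iff_add_eq_0)

lemma scaleC_diff_left: "(a - b) *\<^sub>C (x::'a::complex_inner) = a *\<^sub>C x - b *\<^sub>C x"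
  using scaleC_add_left[of a "- b" x] by (simp add: scaleC_minus_left)

lemma scaleC_sum_right: "c *\<^sub>C (\<Sum>s\<in>S. f s) = (\<Sum>s\<in>S. c *\<^sub>C (f s :: 'a::complex_inner))"
  by (induction S rule: infinite_finite_induct) (auto simp: scaleC_add_right)

lemma cinner_add_right: "cinner x (y + z) = cinner x y + cinner x (z::'a::complex_inner)"
  by (metis cinner_add_left cinner_commute complex_cnj_add)

lemma cinner_scaleC_right: "cinner x (c *\<^sub>C y) = cnj c * cinner x (y::'a::complex_inner)"
  by (metis cinner_commute cinner_scaleC_left complex_cnj_mult)

lemma cinner_zero_left [simp]: "cinner 0 (x::'a::complex_inner) = 0"
  using cinner_add_left[of 0 0 x] by simp

lemma cinner_zero_right [simp]: "cinner (x::'a::complex_inner) 0 = 0"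
  using cinner_add_right[of x 0 0] by simp

lemma cinner_diff_left: "cinner (x - y) z = cinner x z - cinner y (z::'a::complex_inner)"
  using cinner_add_left[of "x - y" y z] by simp

lemma cinner_sum_left: "cinner (\<Sum>s\<in>S. f s) x = (\<Sum>s\<in>S. cinner (f s) (x::'a::complex_inner))"
  by (induction S rule: infinite_finite_induct) (auto simp: cinner_add_left)

lemma cinner_sum_right: "cinner x (\<Sum>s\<in>S. f s) = (\<Sum>s\<in>S. cinner x (f s :: 'a::complex_inner))"
  by (induction S rule: infinite_finite_induct) (auto simp: cinner_add_right)

lemma norm_scaleC: "norm (c *\<^sub>C x) = norm c * norm (x::'a::complex_inner)"
proof -
  have "complex_of_real ((norm (c *\<^sub>C x))\<^sup>2) = c * cnj c * cinner x x"
    by (simp add: cinner_self[symmetric] cinner_scaleC_left cinner_scaleC_right del: of_real_power)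
  also have "\<dots> = complex_of_real ((norm c * norm x)\<^sup>2)"
    by (simp add: cinner_self power_mult_distrib complex_norm_square[symmetric])
  finally show ?thesis
    by (metis abs_norm_cancel abs_mult norm_mult of_real_eq_iff power2_eq_iff_nonneg norm_ge_zero mult_nonneg_nonneg)
qed

lemma cinner_Cauchy_Schwarz: "norm (cinner x y) \<le> norm x * norm (y::'a::complex_inner)"
proof (cases "cinner x y = 0")
  case False
  \<comment> \<open>Multiplying \<open>x\<close> by this unimodular number makes the inner product
    real and nonnegative, so the real Cauchy-Schwarz inequality applies.\<close>
  define c where "c = cnj (cinner x y) / norm (cinner x y)"
  have "cinner (c *\<^sub>C x) y = norm (cinner x y)"
    using False by (simp add: c_def cinner_scaleC_left complex_norm_square[symmetric] power2_eq_square
        mult.commute[of "cnj _"])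
  then have "norm (cinner x y) = inner (c *\<^sub>C x) y"
    by (simp add: inner_eq_Re_cinner)
  also have "\<dots> \<le> norm (c *\<^sub>C x) * norm y"
    by (rule norm_cauchy_schwarz)
  also have "norm c = 1"
    using False by (simp add: c_def norm_divide)
  then have "norm (c *\<^sub>C x) = norm x"
    by (simp add: norm_scaleC)
  finally show ?thesis .
qed simp

lemma bounded_linear_cinner_left: "bounded_linear (\<lambda>x. cinner x (y::'a::complex_inner))"
proof
  show "cinner (r *\<^sub>R x) y = r *\<^sub>R cinner x y" for r x
    by (simp add: scaleR_eq_scaleC cinner_scaleC_left scaleC_complex_def)
  show "\<exists>K. \<forall>x. norm (cinner x y) \<le> norm x * K"
    by (rule exI[of _ "norm y"]) (simp add: cinner_Cauchy_Schwarz)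
qed (rule cinner_add_left)

lemma bounded_cops_apply_scaleC:
  "T \<in> bounded_cops \<Longrightarrow> blinfun_apply T (c *\<^sub>C x) = c *\<^sub>C blinfun_apply T x"
  by (simp add: bounded_cops_def)

lemma bounded_cops_id: "id_blinfun \<in> bounded_cops"
  by (simp add: bounded_cops_def)

lemma bounded_cops_compose:
  "S \<in> bounded_cops \<Longrightarrow> T \<in> bounded_cops \<Longrightarrow> S o\<^sub>L T \<in> bounded_cops"
  by (simp add: bounded_cops_def)

lemma bounded_cops_scaleR: "T \<in> bounded_cops \<Longrightarrow> r *\<^sub>R T \<in> bounded_cops"
  by (simp add: bounded_cops_def blinfun.scaleR_left scaleR_eq_scaleC scaleC_scaleC mult.commute)

lemma bounded_cops_sum: "(\<And>s. s \<in> S \<Longrightarrow> f s \<in> bounded_cops) \<Longrightarrow> (\<Sum>s\<in>S. f s) \<in> bounded_cops"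
  by (simp add: bounded_cops_def blinfun.sum_left scaleC_sum_right)

lemma op_pow_bounded_cops: "T \<in> bounded_cops \<Longrightarrow> op_pow T n \<in> bounded_cops"
  by (induction n) (auto intro: bounded_cops_id bounded_cops_compose)

text \<open>The remainder of the projection onto the span of \<open>B\<close> is orthogonal to the
  projection, so Pythagoras bounds it. The bound controls approximation errors later; the
  orthogonality to \<open>B\<close> supplies the next vector in the Gram-Schmidt process.\<close>

lemma orthonormal_residual_le:
  fixes B :: "'a::complex_inner set"
  assumes "finite B" "\<And>b b'. b \<in> B \<Longrightarrow> b' \<in> B \<Longrightarrow> cinner b b' = (if b = b' then 1 else 0)"
  shows "norm (x - (\<Sum>b\<in>B. cinner x b *\<^sub>C b)) \<le> norm x"
    and "b \<in> B \<Longrightarrow> cinner (x - (\<Sum>b\<in>B. cinner x b *\<^sub>C b)) b = 0"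
proof -
  define Px where "Px = (\<Sum>b\<in>B. cinner x b *\<^sub>C b)"
  have orth: "cinner (x - Px) b = 0" if "b \<in> B" for b
  proof -
    have "cinner Px b = (\<Sum>b'\<in>B. if b' = b then cinner x b' else 0)"
      unfolding Px_def cinner_sum_left cinner_scaleC_left
      by (intro sum.cong) (auto simp: assms that)
    with that assms(1) show ?thesis by (simp add: cinner_diff_left)
  qed
  have "cinner (x - Px) Px = (\<Sum>b\<in>B. cnj (cinner x b) * cinner (x - Px) b)"
    by (subst (2) Px_def) (simp add: cinner_sum_right cinner_scaleC_right)
  also have "\<dots> = 0" by (simp add: orth)
  finally have "inner (x - Px) Px = 0" by (simp add: inner_eq_Re_cinner)
  then have "(norm (x - Px + Px))\<^sup>2 = (norm (x - Px))\<^sup>2 + (norm Px)\<^sup>2"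
    by (intro norm_add_Pythagorean) (simp add: orthogonal_def)
  then have "(norm (x - Px))\<^sup>2 \<le> (norm x)\<^sup>2" by simp
  then show "norm (x - (\<Sum>b\<in>B. cinner x b *\<^sub>C b)) \<le> norm x"
    unfolding Px_def by (rule power2_le_imp_le) simp
  show "b \<in> B \<Longrightarrow> cinner (x - (\<Sum>b\<in>B. cinner x b *\<^sub>C b)) b = 0"
    using orth by (simp add: Px_def)
qed

text \<open>Phrased by reproduction of each \<open>z\<close> rather than by equality of spans,
  because the coefficients \<open>cinner z b\<close> are what is needed: the same formula makes
  sense for vectors that are merely close to \<open>z\<close>.\<close>

lemma Gram_Schmidt:
  fixes Z :: "'a::complex_inner set"
  assumes "finite Z"
  shows "\<exists>B. finite B \<and> (\<forall>b\<in>B. \<forall>b'\<in>B. cinner b b' = (if b = b' then 1 else 0)) \<and>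
    (\<forall>z\<in>Z. (\<Sum>b\<in>B. cinner z b *\<^sub>C b) = z)"
  using assms
proof induction
  case empty
  then show ?case by (intro exI[of _ "{}"]) simp
next
  case (insert z Z)
  then obtain B where B: "finite B" "\<And>b b'. b \<in> B \<Longrightarrow> b' \<in> B \<Longrightarrow> cinner b b' = (if b = b' then 1 else 0)"
    "\<And>z. z \<in> Z \<Longrightarrow> (\<Sum>b\<in>B. cinner z b *\<^sub>C b) = z"
    by auto
  define w where "w = z - (\<Sum>b\<in>B. cinner z b *\<^sub>C b)"
  show ?case
  proof (cases "w = 0")
    case True
    with B show ?thesis by (intro exI[of _ B]) (auto simp: w_def)
  next
    case False
    define e where "e = complex_of_real (1 / norm w) *\<^sub>C w"
    have eb: "cinner e b = 0" if "b \<in> B" for b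
      using orthonormal_residual_le(2)[OF B(1,2) that, of z] by (simp add: e_def cinner_scaleC_left w_def)
    have be: "cinner b e = 0" if "b \<in> B" for b
      using eb[OF that] by (subst cinner_commute) simp
    have "norm e = 1"
      using False by (simp add: e_def norm_scaleC norm_divide)
    then have ee: "cinner e e = 1" by (simp add: cinner_self)
    have "e \<notin> B" using ee eb by force
    have span: "cinner (\<Sum>b\<in>B. c b *\<^sub>C b) e = 0" for c
      by (simp add: cinner_sum_left cinner_scaleC_left be)
    have "cinner z e = cinner w e"
      using span by (simp add: w_def cinner_diff_left)
    also have "\<dots> = norm w"
      using False by (simp add: e_def cinner_scaleC_right cinner_self power2_eq_square)
    finally have "cinner z e *\<^sub>C e = w"
      using False by (simp add: e_def scaleC_scaleC)
    then have "(\<Sum>b\<in>insert e B. cinner z b *\<^sub>C b) = z"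
      using B(1) \<open>e \<notin> B\<close> by (simp add: w_def)
    moreover have "(\<Sum>b\<in>insert e B. cinner z' b *\<^sub>C b) = z'" if "z' \<in> Z" for z'
      using B(1) \<open>e \<notin> B\<close> B(3)[OF that] span[of "cinner z'"] by simp
    moreover have "cinner b b' = (if b = b' then 1 else 0)" if "b \<in> insert e B" "b' \<in> insert e B" for b b'
      using that B(2)[of b b'] eb[of b'] be[of b] ee \<open>e \<notin> B\<close> by (cases "b = e"; cases "b' = e") auto
    ultimately show ?thesis
      using B(1) by (intro exI[of _ "insert e B"]) simp
  qed
qed

section \<open>Spectral measures of a unitary operator\<close>

locale unitary_operator =
  fixes U :: "'h::chilbert_space \<Rightarrow>\<^sub>L 'h"
  assumes unitary: "unitary_op U"
begin

definition E :: "int \<Rightarrow> 'h \<Rightarrow> 'h"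
  where "E m x = blinfun_apply (op_powi U m) x"

lemma op_inverse_unitary:
  "op_inverse U \<in> bounded_cops" "U o\<^sub>L op_inverse U = id_blinfun" "op_inverse U o\<^sub>L U = id_blinfun"
  "is_adjoint U (op_inverse U)"
  using unitary unfolding unitary_op_def by (metis op_inverse_eq)+

lemma op_powi_bounded_cops: "op_powi U m \<in> bounded_cops"
  using unitary op_inverse_unitary(1) by (auto simp: op_powi_def unitary_op_def intro: op_pow_bounded_cops)

lemma op_powi_Suc: "op_powi U (m + 1) = U o\<^sub>L op_powi U m"
proof (cases "m \<ge> 0")
  case True
  then show ?thesis by (simp add: op_powi_def nat_add_distrib)
next
  case False
  define k where "k = nat (- (m + 1))"
  have "nat (- m) = Suc k" using False by (simp add: k_def)
  then have "op_powi U m = op_inverse U o\<^sub>L op_pow (op_inverse U) k"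
    using False by (simp add: op_powi_def)
  then have "U o\<^sub>L op_powi U m = op_pow (op_inverse U) k"
    using op_inverse_unitary(2)
    by (intro blinfun_eqI) (metis blinfun_apply_blinfun_compose blinfun_apply_id_blinfun id_apply)
  \<comment> \<open>At \<open>m = - 1\<close> the definition of \<open>op_powi\<close> changes
    branch; there both sides are the identity.\<close>
  moreover have "op_powi U (m + 1) = op_pow (op_inverse U) k"
    using False by (cases "m = - 1") (auto simp: op_powi_def k_def)
  ultimately show ?thesis by simp
qed

lemma E_0 [simp]: "E 0 x = x"
  by (simp add: E_def op_powi_def)

lemma E_Suc: "E (m + 1) x = U (E m x)"
  by (simp add: E_def op_powi_Suc)

lemma E_pred: "E (m - 1) x = op_inverse U (E m x)"
proof -
  have "op_inverse U (U (E (m - 1) x)) = E (m - 1) x"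
    using op_inverse_unitary(3) by (metis blinfun_apply_blinfun_compose blinfun_apply_id_blinfun id_apply)
  then show ?thesis using E_Suc[of "m - 1" x] by simp
qed

lemma E_add: "E (a + b) x = E a (E b x)"
proof (induction a rule: int_induct[of _ 0])
  case (step1 i)
  then show ?case using E_Suc[of "i + b" x] E_Suc[of i "E b x"] by (simp add: algebra_simps)
next
  case (step2 i)
  then show ?case using E_pred[of "i + b" x] E_pred[of i "E b x"] by (simp add: algebra_simps)
qed simp

lemma E_scaleC: "E m (c *\<^sub>C x) = c *\<^sub>C E m x"
  by (simp add: E_def bounded_cops_apply_scaleC op_powi_bounded_cops)

lemma cinner_E_E: "cinner (E m x) (E m y) = cinner x y"
proof -
  have U: "cinner (U x) (U y) = cinner x y" for x y
    using op_inverse_unitary(3,4) unfolding is_adjoint_def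
    by (metis blinfun_apply_blinfun_compose blinfun_apply_id_blinfun id_apply)
  have V: "cinner (op_inverse U x) (op_inverse U y) = cinner x y" for x y
    using op_inverse_unitary(2) U
    by (metis blinfun_apply_blinfun_compose blinfun_apply_id_blinfun id_apply)
  show ?thesis
    by (induction m rule: int_induct[of _ 0]) (simp_all add: E_Suc E_pred U V)
qed

lemma norm_E [simp]: "norm (E m x) = norm x"
  by (simp add: norm_eq_sqrt_cinner cinner_E_E)

lemma cinner_E_diff: "cinner (E a x) (E b y) = cinner (E (a - b) x) y"
  using cinner_E_E[of b "E (a - b) x" y] by (simp flip: E_add)

text \<open>By unitarity the norm depends on \<open>x\<close> only through the correlations
  \<open>cinner (E m x) x\<close>. A measure with these Fourier coefficients therefore yields an
  isometric model of the orbit.\<close>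

lemma norm_sum_E_square:
  "complex_of_real ((norm (\<Sum>s\<in>S. c s *\<^sub>C E (l s) x))\<^sup>2)
    = (\<Sum>s\<in>S. \<Sum>s'\<in>S. c s * cnj (c s') * cinner (E (l s - l s') x) x)"
  by (simp add: cinner_self[symmetric] cinner_sum_left cinner_sum_right cinner_scaleC_left
      cinner_scaleC_right cinner_E_diff sum_distrib_left del: of_real_power)
     (subst sum.swap, simp add: mult_ac)

end

section \<open>Fejer means and Herglotz' theorem\<close>

lemma borel_measurable_cis_mult [measurable]: "(\<lambda>\<theta>. cis (c * \<theta>)) \<in> borel_measurable borel"
  by (intro borel_measurable_continuous_onI continuous_intros)

text \<open>Orthogonality of characters modulo \<open>Q\<close>: the bound on \<open>i\<close>
  leaves 0 as the only multiple of \<open>Q\<close> in range, so otherwise the geometric ratio is a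
  root of unity different from 1.\<close>

lemma sum_roots_of_unity:
  assumes "\<bar>i\<bar> < int Q"
  shows "(\<Sum>j<Q. cis (of_int i * (2 * pi * real j / real Q))) = (if i = 0 then of_nat Q else 0)"
proof (cases "i = 0")
  case False
  define z where "z = cis (2 * pi * of_int i / real Q)"
  have Q: "Q > 0" using assms by (cases Q) auto
  have "cis (of_int i * (2 * pi * real j / real Q)) = z ^ j" for j
    unfolding z_def Complex.DeMoivre by (simp add: mult_ac)
  moreover have "z ^ Q = 1"
  proof -
    have "z ^ Q = cis (2 * pi * of_int i)"
      using Q unfolding z_def Complex.DeMoivre by simp
    then show ?thesis by (simp add: cis_multiple_2pi)
  qed
  moreover have "z \<noteq> 1"
  proof
    assume "z = 1"
    then have "cos (2 * pi * of_int i / real Q) = 1" by (simp add: z_def complex_eq_iff)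
    then obtain k :: int where "2 * pi * of_int i / real Q = of_int k * 2 * pi"
      using cos_one_2pi_int by blast
    then have "real_of_int i = of_int (k * int Q)"
      using Q by (simp add: field_simps)
    then have "i = k * int Q" by (simp only: of_int_eq_iff)
    with assms False show False
      by (metis abs_mult abs_of_nat mult_le_cancel_right1 not_less of_nat_0_le_iff zero_less_abs_iff mult_zero_left int_one_le_iff_zero_less)
  qed
  ultimately show ?thesis using False by (simp add: geometric_sum)
qed simp

lemma count_fixed_difference:
  "(\<Sum>n<N. \<Sum>n'<N. if int n - int n' = int m then 1 else 0 :: complex) = of_nat (N - m)"
proof -
  have "(\<Sum>n<N. if int n - int n' = int m then 1 else 0 :: complex) = (if n' < N - m then 1 else 0)" for n'
  proof -
    have "(\<Sum>n<N. if int n - int n' = int m then 1 else 0 :: complex)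
        = (\<Sum>n<N. if n = n' + m then 1 else 0)"
      by (intro sum.cong) auto
    then show ?thesis by auto
  qed
  then have "(\<Sum>n<N. \<Sum>n'<N. if int n - int n' = int m then 1 else 0 :: complex)
      = (\<Sum>n'<N. if n' < N - m then 1 else 0)"
    by (subst sum.swap) simp
  also have "\<dots> = of_nat (card ({..<N} \<inter> {n'. n' < N - m}))"
    by (simp add: sum.If_cases)
  also have "{..<N} \<inter> {n'. n' < N - m} = {..<N - m}" by auto
  finally show ?thesis by simp
qed

context unitary_operator begin

text \<open>The weights are those of the Fejer means of the spectral measure, sampled at the
  \<open>2N\<close>-th roots of unity.\<close>

definition fejer_weight :: "'h \<Rightarrow> nat \<Rightarrow> nat \<Rightarrow> real" where
  "fejer_weight y N j =
    (norm (\<Sum>n<N. cis (- of_int (int n) * (2 * pi * real j / real (2 * N))) *\<^sub>C E (int n) y))\<^sup>2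
      / (real (2 * N) * real N * (norm y)\<^sup>2)"

text \<open>Expanding the square leaves sums over \<open>j\<close> of characters with frequency
  \<open>m - n + n'\<close>. Its absolute value is below \<open>2 * N\<close>, which is why that
  many sample points are taken, so only pairs with \<open>n - n' = m\<close> survive. There are
  \<open>N - m\<close> of them, whence the Fejer factor.\<close>

lemma sum_fejer_weight:
  assumes "y \<noteq> 0" "m < N"
  shows "(\<Sum>j<2 * N. complex_of_real (fejer_weight y N j)
      * cis (of_int (int m) * (2 * pi * real j / real (2 * N))))
    = of_real (real (N - m) / real N) * cinner (E (int m) y) y / (norm y)\<^sup>2"
proof -
  define t where "t j = 2 * pi * real j / real (2 * N)" for j
  define d where "d = complex_of_real (real (2 * N) * real N * (norm y)\<^sup>2)"
  have N: "N > 0" using assms by simp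
  have w: "complex_of_real (fejer_weight y N j) * cis (of_int (int m) * t j)
      = (\<Sum>n<N. \<Sum>n'<N. cinner (E (int n - int n') y) y *
          cis (of_int (int m - int n + int n') * t j)) / d" for j
  proof -
    have "complex_of_real (fejer_weight y N j)
        = (\<Sum>n<N. \<Sum>n'<N. cis (- of_int (int n) * t j) * cnj (cis (- of_int (int n') * t j))
            * cinner (E (int n - int n') y) y) / d"
      unfolding fejer_weight_def t_def[symmetric] of_real_divide norm_sum_E_square d_def ..
    moreover have "cis (- of_int (int n) * t j) * cnj (cis (- of_int (int n') * t j))
        * cinner (E (int n - int n') y) y * cis (of_int (int m) * t j)
        = cinner (E (int n - int n') y) y * cis (of_int (int m - int n + int n') * t j)" for n n'
    proof -
      have "cis (of_int (int m - int n + int n') * t j)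
          = cis (- of_int (int n) * t j) * cnj (cis (- of_int (int n') * t j)) * cis (of_int (int m) * t j)"
        by (simp add: cis_mult cis_cnj algebra_simps)
      then show ?thesis by (simp only: mult_ac)
    qed
    ultimately show ?thesis
      by (simp only: times_divide_eq_left sum_distrib_right)
  qed
  have "(\<Sum>j<2 * N. complex_of_real (fejer_weight y N j) * cis (of_int (int m) * t j))
      = (\<Sum>n<N. \<Sum>n'<N. cinner (E (int n - int n') y) y *
          (\<Sum>j<2 * N. cis (of_int (int m - int n + int n') * t j))) / d"
    unfolding w sum_divide_distrib[symmetric] sum_distrib_left
    by (simp only: sum.swap[of _ "{..<N}" "{..<2 * N}"])
  also have "(\<Sum>n<N. \<Sum>n'<N. cinner (E (int n - int n') y) y *
          (\<Sum>j<2 * N. cis (of_int (int m - int n + int n') * t j)))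
      = (\<Sum>n<N. \<Sum>n'<N. (cinner (E (int m) y) y * of_nat (2 * N)) *
          (if int n - int n' = int m then 1 else 0))"
  proof (intro sum.cong refl)
    fix n n' assume n: "n \<in> {..<N}" "n' \<in> {..<N}"
    have "(\<Sum>j<2 * N. cis (of_int (int m - int n + int n') * t j))
        = (if int m - int n + int n' = 0 then of_nat (2 * N) else 0)"
      unfolding t_def by (rule sum_roots_of_unity) (use n assms in auto)
    moreover have "int m - int n + int n' = 0 \<longleftrightarrow> int n - int n' = int m" by linarith
    ultimately show "cinner (E (int n - int n') y) y *
          (\<Sum>j<2 * N. cis (of_int (int m - int n + int n') * t j))
        = (cinner (E (int m) y) y * of_nat (2 * N)) * (if int n - int n' = int m then 1 else 0)"
      by auto
  qed
  also have "\<dots> = cinner (E (int m) y) y * of_nat (2 * N) * of_nat (N - m)"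
    by (simp only: sum_distrib_left[symmetric] count_fixed_difference)
  also have "\<dots> / d = of_real (real (N - m) / real N) * cinner (E (int m) y) y / (norm y)\<^sup>2"
    using N assms(1) by (simp add: d_def field_simps)
  finally show ?thesis by (simp add: t_def)
qed

lemma fejer_weight_nonneg: "fejer_weight y N j \<ge> 0"
  by (simp add: fejer_weight_def)

lemma sum_fejer_weight_eq_1:
  assumes "y \<noteq> 0" "N > 0"
  shows "(\<Sum>j<2 * N. fejer_weight y N j) = 1"
proof -
  have "complex_of_real (\<Sum>j<2 * N. fejer_weight y N j) = 1"
    using sum_fejer_weight[of y 0 N] assms by (simp add: cinner_self)
  then show ?thesis by (simp only: of_real_eq_1_iff)
qed

text \<open>The case \<open>m = 0\<close> of the preceding computation gives total mass 1. The
  interval starts at -1 because an atom may sit at 0, while tightness is expressed with intervals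
  open on the left.\<close>

lemma fejer_distribution:
  assumes "y \<noteq> 0" "N > 0"
  obtains M where "real_distribution M" "measure M {-1<..2 * pi} = 1"
    "\<And>m. m < N \<Longrightarrow> (LINT \<theta>|M. cis (of_int (int m) * \<theta>))
      = of_real (real (N - m) / real N) * cinner (E (int m) y) y / (norm y)\<^sup>2"
proof -
  define w where "w j = (if j < 2 * N then fejer_weight y N j else 0)" for j
  define t where "t j = 2 * pi * real j / real (2 * N)" for j
  define q where "q = embed_pmf w"
  have "(\<integral>\<^sup>+j. ennreal (w j) \<partial>count_space UNIV) = (\<Sum>j<2 * N. ennreal (w j))"
    by (rule nn_integral_count_space') (auto simp: w_def)
  also have "\<dots> = ennreal (\<Sum>j<2 * N. w j)"
    by (rule sum_ennreal) (simp add: w_def fejer_weight_nonneg)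
  also have "(\<Sum>j<2 * N. w j) = 1"
    using sum_fejer_weight_eq_1[OF assms] by (simp add: w_def)
  finally have nn: "(\<integral>\<^sup>+j. ennreal (w j) \<partial>count_space UNIV) = 1" by simp
  have pmf: "pmf q j = w j" for j
    unfolding q_def by (rule pmf_embed_pmf[OF _ nn]) (simp add: w_def fejer_weight_nonneg)
  have set_q: "j < 2 * N" if "j \<in> set_pmf q" for j
    using that pmf[of j] by (auto simp: set_pmf_iff w_def split: if_splits)
  define M where "M = distr (measure_pmf q) borel t"
  interpret M: prob_space M
    unfolding M_def by (rule measure_pmf.prob_space_distr) simp
  show thesis
  proof
    show "real_distribution M"
      by standard (simp add: M_def)
    have "measure M {-1<..2 * pi} = measure (measure_pmf q) (t -` {-1<..2 * pi})"
      unfolding M_def by (subst measure_distr) auto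
    also have "\<dots> = 1"
    proof -
      have "t j \<in> {-1<..2 * pi}" if "j \<in> set_pmf q" for j
      proof -
        have "real j \<le> real (2 * N)" using set_q[OF that] by simp
        then have "t j \<le> 2 * pi" using assms(2) by (simp add: t_def divide_le_eq)
        moreover have "0 \<le> t j" by (simp add: t_def)
        ultimately show ?thesis by auto
      qed
      then show ?thesis
        by (intro measure_pmf.prob_eq_1[THEN iffD2]) (auto simp: AE_measure_pmf_iff)
    qed
    finally show "measure M {-1<..2 * pi} = 1" .
    fix m assume m: "m < N"
    have "(LINT \<theta>|M. cis (of_int (int m) * \<theta>)) = (LINT j|measure_pmf q. cis (of_int (int m) * t j))"
      unfolding M_def by (rule integral_distr) auto
    also have "\<dots> = (\<Sum>j<2 * N. pmf q j *\<^sub>R cis (of_int (int m) * t j))"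
      by (rule integral_measure_pmf) (auto simp: set_q)
    also have "\<dots> = (\<Sum>j<2 * N. complex_of_real (fejer_weight y N j) * cis (of_int (int m) * t j))"
      by (intro sum.cong) (auto simp: pmf w_def scaleR_conv_of_real)
    finally show "(LINT \<theta>|M. cis (of_int (int m) * \<theta>))
      = of_real (real (N - m) / real N) * cinner (E (int m) y) y / (norm y)\<^sup>2"
      using sum_fejer_weight[OF assms(1) m] by (simp add: t_def)
  qed
qed

text \<open>The Fejer measures live in one bounded interval, so they are tight and a subsequence
  converges weakly; the Fejer factors tend to 1, so the limit has the right Fourier coefficients.
  Since \<open>M\<close> is a probability measure, the total mass appears separately as the square
  of \<open>norm y\<close>.\<close>

theorem Herglotz:
  obtains M where "real_distribution M"
    "\<And>m. cinner (E m y) y = of_real ((norm y)\<^sup>2) * (LINT \<theta>|M. cis (of_int m * \<theta>))"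
proof (cases "y = 0")
  case True
  have "real_distribution (return borel (0::real))"
    by (intro real_distribution.intro prob_space_return real_distribution_axioms.intro) auto
  with True show ?thesis by (intro that) (auto simp: E_def blinfun.zero_right)
next
  case y: False
  \<comment> \<open>Using \<open>Suc N\<close> avoids empty Fejer means, and each fixed
    \<open>m\<close> is covered as soon as \<open>m \<le> N\<close>.\<close>
  have "\<exists>M. real_distribution M \<and> measure M {-1<..2 * pi} = 1 \<and>
      (\<forall>m < Suc N. (LINT \<theta>|M. cis (of_int (int m) * \<theta>))
      = of_real (real (Suc N - m) / real (Suc N)) * cinner (E (int m) y) y / (norm y)\<^sup>2)" for N
    by (rule fejer_distribution[OF y, of "Suc N"]) auto
  then obtain \<mu> where \<mu>: "\<And>N. real_distribution (\<mu> N)" "\<And>N. measure (\<mu> N) {-1<..2 * pi} = 1"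
    "\<And>N m. m < Suc N \<Longrightarrow> (LINT \<theta>|\<mu> N. cis (of_int (int m) * \<theta>))
      = of_real (real (Suc N - m) / real (Suc N)) * cinner (E (int m) y) y / (norm y)\<^sup>2"
    by metis
  have "tight \<mu>"
    unfolding tight_def
  proof (intro conjI allI impI \<mu>)
    fix e :: real assume "e > 0"
    then show "\<exists>a b. a < b \<and> (\<forall>n. 1 - e < measure (\<mu> n) {a<..b})"
      using \<mu>(2) by (intro exI[of _ "-1"] exI[of _ "2 * pi"]) (auto intro: less_trans[of _ 0])
  qed
  from tight_imp_convergent_subsubsequence[OF this strict_mono_id]
  obtain s M where s: "strict_mono s" and M: "real_distribution M"
    and conv: "weak_conv_m (\<mu> \<circ> s) M" by (auto simp: comp_def)
  interpret M: real_distribution M by (rule M)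
  have nat: "cinner (E (int m) y) y = of_real ((norm y)\<^sup>2) * (LINT \<theta>|M. cis (of_int (int m) * \<theta>))" for m
  proof -
    have "(\<lambda>N. LINT \<theta>|(\<mu> \<circ> s) N. cis (of_int (int m) * \<theta>)) \<longlonglongrightarrow> (LINT \<theta>|M. cis (of_int (int m) * \<theta>))"
    proof (rule weak_conv_imp_integral_bdd_continuous_conv)
      show "weak_conv_m (\<mu> \<circ> s) M" by (rule conv)
    qed (auto simp: \<mu> M cis_conv_exp intro!: continuous_intros)
    moreover have "(\<lambda>N. LINT \<theta>|(\<mu> \<circ> s) N. cis (of_int (int m) * \<theta>)) \<longlonglongrightarrow> cinner (E (int m) y) y / (norm y)\<^sup>2"
    proof -
      have "(\<lambda>N. real (Suc N - m) / real (Suc N)) \<longlonglongrightarrow> 1"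
        by real_asymp
      then have "(\<lambda>N. of_real (real (Suc N - m) / real (Suc N)) * (cinner (E (int m) y) y / (norm y)\<^sup>2))
          \<longlonglongrightarrow> of_real 1 * (cinner (E (int m) y) y / (norm y)\<^sup>2)"
        by (intro tendsto_intros)
      moreover have "\<forall>\<^sub>F N in sequentially. of_real (real (Suc N - m) / real (Suc N)) * (cinner (E (int m) y) y / (norm y)\<^sup>2)
          = (LINT \<theta>|\<mu> N. cis (of_int (int m) * \<theta>))"
        using eventually_ge_at_top[of m] by eventually_elim (subst \<mu>(3), auto)
      ultimately have "(\<lambda>N. LINT \<theta>|\<mu> N. cis (of_int (int m) * \<theta>)) \<longlonglongrightarrow> cinner (E (int m) y) y / (norm y)\<^sup>2"
        by (simp add: Lim_transform_eventually)
      from LIMSEQ_subseq_LIMSEQ[OF this s] show ?thesis by (simp add: comp_def)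
    qed
    ultimately have "(LINT \<theta>|M. cis (of_int (int m) * \<theta>)) = cinner (E (int m) y) y / (norm y)\<^sup>2"
      by (rule LIMSEQ_unique)
    with y show ?thesis by (simp add: field_simps)
  qed
  have "cinner (E m y) y = of_real ((norm y)\<^sup>2) * (LINT \<theta>|M. cis (of_int m * \<theta>))" for m
  proof (cases "m \<ge> 0")
    case True
    with nat[of "nat m"] show ?thesis by simp
  next
    case False
    \<comment> \<open>Unitarity moves \<open>E m\<close> to the other argument as
      \<open>E (- m)\<close>, so negative coefficients are conjugates of positive ones, as they are
      for a positive measure.\<close>
    have "cinner (E m y) y = cnj (cinner (E (int (nat (- m))) y) y)"
      using False cinner_E_diff[of 0 y "- m" y] by (simp flip: cinner_commute)
    also have "\<dots> = of_real ((norm y)\<^sup>2) * (LINT \<theta>|M. cis (of_int m * \<theta>))"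
      using False unfolding nat by (simp add: cis_cnj flip: Bochner_Integration.integral_cnj)
    finally show ?thesis .
  qed
  with M show ?thesis by (rule that)
qed

end

text \<open>Both squares expand into the same quadratic form in the correlations. Up to the factor
  \<open>norm y\<close>, sending \<open>E m y\<close> to the character
  \<open>cis (m * \<theta>)\<close> is thus an isometry.\<close>

lemma (in unitary_operator) norm_sum_E_spectral:
  assumes M: "real_distribution M"
    and spec: "\<And>m. cinner (E m y) y = of_real ((norm y)\<^sup>2) * (LINT \<theta>|M. cis (of_int m * \<theta>))"
  shows "(norm (\<Sum>s\<in>S. c s *\<^sub>C E (l s) y))\<^sup>2
    = (norm y)\<^sup>2 * (LINT \<theta>|M. (norm (\<Sum>s\<in>S. c s * cis (of_int (l s) * \<theta>)))\<^sup>2)"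
proof -
  interpret M: real_distribution M by (rule M)
  have int: "integrable M (\<lambda>\<theta>. a * cis (b * \<theta>))" for a b
    by (rule M.integrable_const_bound[of _ "norm a"]) (auto simp: norm_mult)
  have sq: "complex_of_real ((norm (\<Sum>s\<in>S. c s * cis (of_int (l s) * \<theta>)))\<^sup>2)
      = (\<Sum>s\<in>S. \<Sum>s'\<in>S. c s * cnj (c s') * cis (of_int (l s - l s') * \<theta>))" for \<theta>
    unfolding complex_norm_square cnj_sum sum_product
  proof (intro sum.cong refl)
    fix s s'
    have "cis (of_int (l s - l s') * \<theta>) = cis (of_int (l s) * \<theta>) * cnj (cis (of_int (l s') * \<theta>))"
      by (simp add: cis_mult cis_cnj left_diff_distrib)
    then show "c s * cis (of_int (l s) * \<theta>) * cnj (c s' * cis (of_int (l s') * \<theta>))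
        = c s * cnj (c s') * cis (of_int (l s - l s') * \<theta>)"
      by (simp only: complex_cnj_mult mult_ac)
  qed
  have "complex_of_real (LINT \<theta>|M. (norm (\<Sum>s\<in>S. c s * cis (of_int (l s) * \<theta>)))\<^sup>2)
      = (LINT \<theta>|M. (\<Sum>s\<in>S. \<Sum>s'\<in>S. c s * cnj (c s') * cis (of_int (l s - l s') * \<theta>)))"
    by (simp only: integral_complex_of_real[symmetric] sq)
  also have "\<dots> = (\<Sum>s\<in>S. \<Sum>s'\<in>S. c s * cnj (c s') * (LINT \<theta>|M. cis (of_int (l s - l s') * \<theta>)))"
    using int by (simp add: Bochner_Integration.integral_sum)
  finally have "complex_of_real ((norm (\<Sum>s\<in>S. c s *\<^sub>C E (l s) y))\<^sup>2)
    = complex_of_real ((norm y)\<^sup>2 * (LINT \<theta>|M. (norm (\<Sum>s\<in>S. c s * cis (of_int (l s) * \<theta>)))\<^sup>2))"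
    unfolding norm_sum_E_square spec of_real_mult by (simp only: sum_distrib_left mult_ac)
  then show ?thesis by (simp only: of_real_eq_iff)
qed

text \<open>Dominated convergence runs along a sequence, whereas the Cauchy property concerns pairs
  of indices. Its failure is therefore recorded by two index sequences tending to infinity.\<close>

lemma not_Cauchy_sequences:
  fixes X :: "nat \<Rightarrow> 'b::metric_space"
  assumes "\<not> Cauchy X"
  obtains e f g where "e > 0" "filterlim f at_top sequentially" "filterlim g at_top sequentially"
    "\<And>j. e \<le> dist (X (f j)) (X (g j))"
proof -
  from assms obtain e where e: "e > 0" "\<And>M. \<exists>m\<ge>M. \<exists>n\<ge>M. e \<le> dist (X m) (X n)"
    unfolding Cauchy_def by (auto simp: not_less)
  then obtain f g where "\<And>M. f M \<ge> M" "\<And>M. g M \<ge> M" "\<And>M. e \<le> dist (X (f M)) (X (g M))"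
    by metis
  with e(1) show ?thesis
    by (intro that[of e f g]) (auto intro!: filterlim_at_top_mono[OF filterlim_ident])
qed

section \<open>Multiparameter polynomial averages\<close>

locale polynomial_averages = unitary_operator U
  for U :: "'h::chilbert_space \<Rightarrow>\<^sub>L 'h" +
  fixes r :: nat and p :: "nat \<Rightarrow> int poly"
begin

definition cube :: "nat \<Rightarrow> (nat \<Rightarrow> nat) set"
  where "cube N = {1..r} \<rightarrow>\<^sub>E {1..N}"

text \<open>Polymorphic in the values, since operators, vectors and complex numbers are all
  averaged; \<open>linear_mean\<close> passes from one to another.\<close>

definition mean :: "((nat \<Rightarrow> nat) \<Rightarrow> 'b::real_vector) \<Rightarrow> nat \<Rightarrow> 'b"
  where "mean f N = (1 / real N ^ r) *\<^sub>R (\<Sum>n\<in>cube N. f n)"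

definition P :: "(nat \<Rightarrow> nat) \<Rightarrow> nat \<Rightarrow> int"
  where "P n i = poly (p i) (int (n i))"

text \<open>Integer linear forms in the polynomial values treat a single exponent and the final
  negative sum of exponents alike.\<close>

definition L :: "(nat \<Rightarrow> int) \<Rightarrow> (nat \<Rightarrow> nat) \<Rightarrow> int"
  where "L l n = (\<Sum>i=1..r. l i * P n i)"

definition phase :: "(nat \<Rightarrow> real) \<Rightarrow> (nat \<Rightarrow> nat) \<Rightarrow> complex"
  where "phase t n = cis (\<Sum>i=1..r. t i * of_int (P n i))"

text \<open>Unlike mere convergence of the means, convergence after twisting by every phase is inherited
  by products with matrix coefficients of powers of \<open>U\<close>: by the spectral theorem such a
  coefficient is a superposition of phases.\<close>

definition good :: "((nat \<Rightarrow> nat) \<Rightarrow> complex) \<Rightarrow> bool"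
  where "good \<phi> \<longleftrightarrow> (\<exists>B. \<forall>n. norm (\<phi> n) \<le> B) \<and> (\<forall>t. convergent (mean (\<lambda>n. phase t n * \<phi> n)))"

lemma finite_cube [simp]: "finite (cube N)"
  by (simp add: cube_def finite_PiE)

lemma card_cube [simp]: "card (cube N) = N ^ r"
  by (simp add: cube_def card_PiE)

lemma norm_mean_le:
  assumes "\<And>n. n \<in> cube N \<Longrightarrow> norm (f n) \<le> B" "B \<ge> 0"
  shows "norm (mean f N :: 'b::real_normed_vector) \<le> B"
proof -
  have "norm (\<Sum>n\<in>cube N. f n) \<le> real (card (cube N)) * B"
    by (rule sum_norm_bound) (rule assms)
  then have "norm (\<Sum>n\<in>cube N. f n) / real N ^ r \<le> real N ^ r * B / real N ^ r"
    by (intro divide_right_mono) auto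
  then have "norm (mean f N) \<le> real N ^ r * B / real N ^ r"
    by (simp add: mean_def)
  also have "\<dots> \<le> B" using assms(2) by simp
  finally show ?thesis .
qed

lemma mean_add: "mean (\<lambda>n. f n + g n) N = mean f N + mean g N"
  by (simp add: mean_def sum.distrib scaleR_add_right)

lemma mean_diff: "mean (\<lambda>n. f n - g n) N = mean f N - mean g N"
  by (simp add: mean_def sum_subtractf scaleR_diff_right)

lemma linear_mean: "linear g \<Longrightarrow> g (mean f N) = mean (\<lambda>n. g (f n)) N"
  by (simp add: mean_def linear_scale linear_sum)

text \<open>A phase is a product over the coordinates, so its mean over the cube is a product of
  one-variable Weyl means.\<close>

lemma good_one: "good (\<lambda>_. 1)"
  unfolding good_def
proof (intro conjI allI)
  fix t
  have phase: "phase t n = (\<Prod>i=1..r. cis (t i * of_int (P n i)))" for n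
  proof -
    have "cis (\<Sum>i\<in>I. f i) = (\<Prod>i\<in>I. cis (f i))" for I :: "nat set" and f
      by (induction I rule: infinite_finite_induct) (auto simp flip: cis_mult)
    then show ?thesis by (simp add: phase_def)
  qed
  have mean_N: "mean (phase t) N = (\<Prod>i=1..r. (\<Sum>n=1..N. cis (t i * of_int (poly (p i) (int n)))) / of_nat N)" for N
  proof -
    have "(\<Prod>i=1..r. \<Sum>n=1..N. cis (t i * of_int (poly (p i) (int n)))) = (\<Sum>n\<in>cube N. phase t n)"
      unfolding cube_def phase P_def by (rule prod_sum_PiE) auto
    then show ?thesis by (simp add: mean_def prod_dividef scaleR_conv_of_real)
  qed
  \<comment> \<open>Weyl means start at 0 and cube coordinates at 1, so the polynomial is replaced
    by its translate \<open>p(X + 1)\<close>.\<close>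
  have shift: "(\<Sum>n=1..N. cis (t i * of_int (poly (p i) (int n))))
      = (\<Sum>n<N. cis (t i * of_int (poly (pcompose (p i) [:1, 1:]) (int n))))" for i N
    by (simp add: sum.atLeast1_atMost_eq poly_pcompose add.commute)
  have mean: "mean (phase t) = (\<lambda>N. \<Prod>i=1..r.
      (\<Sum>n<N. cis (t i * of_int (poly (pcompose (p i) [:1, 1:]) (int n)))) / of_nat N)"
    unfolding mean_N shift ..
  have "\<exists>c. (\<lambda>N. (\<Sum>n<N. cis (t i * of_int (poly (pcompose (p i) [:1, 1:]) (int n)))) / of_nat N) \<longlonglongrightarrow> c" for i
    using Weyl_convergent[of "t i"] by (simp add: convergent_def)
  then obtain c where "(\<lambda>N. (\<Sum>n<N. cis (t i * of_int (poly (pcompose (p i) [:1, 1:]) (int n)))) / of_nat N)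
      \<longlonglongrightarrow> c i" for i by metis
  then have "mean (phase t) \<longlonglongrightarrow> (\<Prod>i=1..r. c i)"
    unfolding mean by (rule tendsto_prod)
  then show "convergent (mean (\<lambda>n. phase t n * 1))"
    by (auto simp: convergent_def)
qed (auto intro: exI[of _ 1])

lemma norm_phase [simp]: "norm (phase t n) = 1"
  by (simp add: phase_def)

lemma phase_add: "phase s n * phase t n = phase (\<lambda>i. s i + t i) n"
  by (simp add: phase_def cis_mult distrib_right sum.distrib)

lemma good_phase: "good \<phi> \<Longrightarrow> good (\<lambda>n. phase t n * \<phi> n)"
  by (simp add: good_def norm_mult phase_add flip: mult.assoc)

lemma phase_spectral: "phase (\<lambda>i. \<theta> * of_int (l i)) n = cis (of_int (L l n) * \<theta>)"
  by (simp add: phase_def L_def sum_distrib_left mult_ac)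

text \<open>One spectral measure, that of \<open>y\<close>, serves all averages: differences of
  vector averages have, up to \<open>norm y\<close>, the same norms as differences of the scalar
  averages \<open>G N\<close> in \<open>L^2(M)\<close>. Goodness with frequencies
  \<open>\<theta> * l i\<close> makes \<open>G N \<theta>\<close> converge for each
  \<open>\<theta>\<close>, and \<open>G\<close> is uniformly bounded.\<close>

theorem convergent_mean_good_vector:
  assumes \<phi>: "good \<phi>"
  shows "convergent (mean (\<lambda>n. \<phi> n *\<^sub>C E (L l n) y))"
proof (rule Cauchy_convergent, rule ccontr)
  define X where "X = mean (\<lambda>n. \<phi> n *\<^sub>C E (L l n) y)"
  assume "\<not> Cauchy (mean (\<lambda>n. \<phi> n *\<^sub>C E (L l n) y))"
  then have "\<not> Cauchy X" by (simp add: X_def)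
  then obtain e f g where e: "e > 0" and fg: "filterlim f at_top sequentially" "filterlim g at_top sequentially"
    and dist: "\<And>j. e \<le> dist (X (f j)) (X (g j))"
    by (rule not_Cauchy_sequences) blast
  obtain M where M: "real_distribution M"
    "\<And>m. cinner (E m y) y = of_real ((norm y)\<^sup>2) * (LINT \<theta>|M. cis (of_int m * \<theta>))"
    by (rule Herglotz[of y]) blast
  interpret M: real_distribution M by (rule M)
  define G where "G N \<theta> = mean (\<lambda>n. phase (\<lambda>i. \<theta> * of_int (l i)) n * \<phi> n) N" for N \<theta>
  obtain B where B: "\<And>n. norm (\<phi> n) \<le> B" using \<phi> by (auto simp: good_def)
  then have B0: "B \<ge> 0" using norm_ge_zero order_trans by blast
  have GB: "norm (G N \<theta>) \<le> B" for N \<theta>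
    unfolding G_def by (rule norm_mean_le) (auto simp: norm_mult B B0)
  have key: "(norm (X N - X K))\<^sup>2 = (norm y)\<^sup>2 * (LINT \<theta>|M. (norm (G N \<theta> - G K \<theta>))\<^sup>2)" for N K
  proof -
    \<comment> \<open>The difference of two averages is written as one linear combination over the
      union of both cubes, so that the isometry applies to it directly.\<close>
    define c where "c n = (if n \<in> cube N then \<phi> n / of_nat N ^ r else 0)
      - (if n \<in> cube K then \<phi> n / of_nat K ^ r else 0)" for n
    let ?S = "cube N \<union> cube K"
    have split: "(\<Sum>n\<in>?S. if n \<in> cube N' then h n else 0) = (\<Sum>n\<in>cube N'. h n)"
      if "cube N' \<subseteq> ?S" for N' and h :: "_ \<Rightarrow> 'z::comm_monoid_add"
      using that by (simp add: sum.inter_restrict[symmetric] Int_absorb1)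
    have "X N - X K = (\<Sum>n\<in>?S. c n *\<^sub>C E (L l n) y)"
    proof -
      have "(\<Sum>n\<in>?S. c n *\<^sub>C E (L l n) y)
          = (\<Sum>n\<in>?S. if n \<in> cube N then (\<phi> n / of_nat N ^ r) *\<^sub>C E (L l n) y else 0)
          - (\<Sum>n\<in>?S. if n \<in> cube K then (\<phi> n / of_nat K ^ r) *\<^sub>C E (L l n) y else 0)"
        unfolding sum_subtractf[symmetric] c_def by (intro sum.cong) (auto simp: scaleC_diff_left scaleC_minus_left)
      then show ?thesis
        by (simp add: split X_def mean_def scaleR_eq_scaleC scaleC_sum_right scaleC_scaleC)
    qed
    moreover have "G N \<theta> - G K \<theta> = (\<Sum>n\<in>?S. c n * cis (of_int (L l n) * \<theta>))" for \<theta>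
    proof -
      have "(\<Sum>n\<in>?S. c n * cis (of_int (L l n) * \<theta>))
          = (\<Sum>n\<in>?S. if n \<in> cube N then (\<phi> n / of_nat N ^ r) * cis (of_int (L l n) * \<theta>) else 0)
          - (\<Sum>n\<in>?S. if n \<in> cube K then (\<phi> n / of_nat K ^ r) * cis (of_int (L l n) * \<theta>) else 0)"
        unfolding sum_subtractf[symmetric] c_def by (intro sum.cong) (auto simp: left_diff_distrib)
      then show ?thesis
        by (simp add: split G_def mean_def phase_spectral scaleR_conv_of_real sum_distrib_left mult_ac)
    qed
    ultimately show ?thesis
      by (simp add: norm_sum_E_spectral[OF M])
  qed
  have [measurable]: "G N \<in> borel_measurable borel" for N
    unfolding G_def mean_def phase_spectral by (simp add: scaleR_conv_of_real) measurable
  have "(\<lambda>j. LINT \<theta>|M. (norm (G (f j) \<theta> - G (g j) \<theta>))\<^sup>2) \<longlonglongrightarrow> (LINT \<theta>|M. 0)"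
  proof (rule integral_dominated_convergence[where w = "\<lambda>_. (2 * B)\<^sup>2"])
    show "AE \<theta> in M. (\<lambda>j. (norm (G (f j) \<theta> - G (g j) \<theta>))\<^sup>2) \<longlonglongrightarrow> 0"
    proof (rule AE_I2)
      fix \<theta>
      from \<phi> have "convergent (\<lambda>N. G N \<theta>)"
        by (simp add: good_def G_def)
      then obtain z where "(\<lambda>N. G N \<theta>) \<longlonglongrightarrow> z" by (auto simp: convergent_def)
      then have "(\<lambda>j. G (f j) \<theta> - G (g j) \<theta>) \<longlonglongrightarrow> z - z"
        using fg by (intro tendsto_diff) (auto intro: filterlim_compose)
      then have "(\<lambda>j. (norm (G (f j) \<theta> - G (g j) \<theta>))\<^sup>2) \<longlonglongrightarrow> (norm (z - z))\<^sup>2"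
        by (intro tendsto_power tendsto_norm)
      then show "(\<lambda>j. (norm (G (f j) \<theta> - G (g j) \<theta>))\<^sup>2) \<longlonglongrightarrow> 0" by simp
    qed
    show "AE \<theta> in M. norm ((norm (G (f j) \<theta> - G (g j) \<theta>))\<^sup>2) \<le> (2 * B)\<^sup>2" for j
    proof (rule AE_I2)
      fix \<theta>
      have "norm (G (f j) \<theta> - G (g j) \<theta>) \<le> 2 * B"
        using norm_triangle_ineq4[of "G (f j) \<theta>" "G (g j) \<theta>"] GB[of "f j" \<theta>] GB[of "g j" \<theta>] by linarith
      from power_mono[OF this norm_ge_zero, of 2]
      show "norm ((norm (G (f j) \<theta> - G (g j) \<theta>))\<^sup>2) \<le> (2 * B)\<^sup>2" by simp
    qed
  qed auto
  then have lim: "(\<lambda>j. (norm (X (f j) - X (g j)))\<^sup>2) \<longlonglongrightarrow> (norm y)\<^sup>2 * 0"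
    unfolding key by (intro tendsto_mult_left) simp
  have "e\<^sup>2 \<le> (norm (X (f j) - X (g j)))\<^sup>2" for j
    using dist[of j] e by (intro power_mono) (auto simp: dist_norm)
  then have "e\<^sup>2 \<le> (norm y)\<^sup>2 * 0"
    by (intro LIMSEQ_le_const[OF lim]) blast
  with e show False by simp
qed

text \<open>A phase times \<open>\<phi>\<close> is again good, so the corresponding vector averages
  converge; applying the bounded functional \<open>?g\<close> gives the scalar averages. Complex
  linearity of \<open>T\<close> lets the scalars pass through.\<close>

lemma good_mult_correlation:
  assumes \<phi>: "good \<phi>" and T: "T \<in> bounded_cops"
  shows "good (\<lambda>n. \<phi> n * cinner (blinfun_apply T (E (L l n) y)) b)"
  unfolding good_def
proof (intro conjI allI)
  obtain B where B: "\<And>n. norm (\<phi> n) \<le> B" using \<phi> by (auto simp: good_def)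
  then have B0: "B \<ge> 0" using norm_ge_zero order_trans by blast
  have "norm (\<phi> n * cinner (blinfun_apply T (E (L l n) y)) b) \<le> B * (norm T * norm y * norm b)" for n
  proof -
    have "norm (cinner (blinfun_apply T (E (L l n) y)) b) \<le> norm (blinfun_apply T (E (L l n) y)) * norm b"
      by (rule cinner_Cauchy_Schwarz)
    also have "\<dots> \<le> norm T * norm y * norm b"
      using norm_blinfun[of T "E (L l n) y"] by (simp add: mult_right_mono)
    finally show ?thesis
      unfolding norm_mult using B B0 by (intro mult_mono) auto
  qed
  then show "\<exists>B. \<forall>n. norm (\<phi> n * cinner (blinfun_apply T (E (L l n) y)) b) \<le> B" by blast
next
  fix t
  let ?g = "\<lambda>x. cinner (blinfun_apply T x) b"
  have g: "bounded_linear ?g"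
    by (rule bounded_linear_compose[OF bounded_linear_cinner_left blinfun.bounded_linear_right])
  have "convergent (mean (\<lambda>n. (phase t n * \<phi> n) *\<^sub>C E (L l n) y))"
    by (intro convergent_mean_good_vector good_phase \<phi>)
  then have "convergent (\<lambda>N. ?g (mean (\<lambda>n. (phase t n * \<phi> n) *\<^sub>C E (L l n) y) N))"
    using bounded_linear.tendsto[OF g] by (auto simp: convergent_def)
  then show "convergent (mean (\<lambda>n. phase t n * (\<phi> n * cinner (blinfun_apply T (E (L l n) y)) b)))"
    by (simp add: linear_mean[OF bounded_linear.linear[OF g]] bounded_cops_apply_scaleC T
        cinner_scaleC_left mult.assoc)
qed

section \<open>Approximation by finite sums of good scalars times fixed vectors\<close>

inductive_set simple :: "((nat \<Rightarrow> nat) \<Rightarrow> 'h) set" where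
  zero: "(\<lambda>_. 0) \<in> simple"
| add: "V \<in> simple \<Longrightarrow> good \<phi> \<Longrightarrow> (\<lambda>n. V n + \<phi> n *\<^sub>C y) \<in> simple"

lemma simple_plus: "W \<in> simple \<Longrightarrow> V \<in> simple \<Longrightarrow> (\<lambda>n. V n + W n) \<in> simple"
proof (induction rule: simple.induct)
  case (add W \<phi> y)
  then show ?case using simple.add[of "\<lambda>n. V n + W n" \<phi> y] by (simp add: add.assoc)
qed simp

lemma simple_sum:
  assumes "\<And>s. s \<in> S \<Longrightarrow> good (\<phi> s)"
  shows "(\<lambda>n. \<Sum>s\<in>S. \<phi> s n *\<^sub>C y s) \<in> simple"
  using assms
proof (induction S rule: infinite_finite_induct)
  case (insert s S)
  then show ?case using simple.add[of "\<lambda>n. \<Sum>s\<in>S. \<phi> s n *\<^sub>C y s" "\<phi> s" "y s"]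
    by (simp add: add.commute)
qed (auto intro: simple.zero)

text \<open>The error is uniform over all cubes, so it is not enlarged by averaging. Only cube
  points count, because the polynomials are known to be nonnegative only at positive
  arguments.\<close>

definition approximable :: "((nat \<Rightarrow> nat) \<Rightarrow> 'h) \<Rightarrow> bool"
  where "approximable V \<longleftrightarrow> (\<forall>e>0. \<exists>W\<in>simple. \<forall>N. \<forall>n\<in>cube N. norm (V n - W n) \<le> e)"

lemma approximable_add:
  assumes "approximable V" "approximable V'"
  shows "approximable (\<lambda>n. V n + V' n)"
  unfolding approximable_def
proof (intro allI impI)
  fix e :: real assume "e > 0"
  then have "e / 2 > 0" by simp
  with assms obtain W W' where W: "W \<in> simple" "\<And>N n. n \<in> cube N \<Longrightarrow> norm (V n - W n) \<le> e / 2"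
    "W' \<in> simple" "\<And>N n. n \<in> cube N \<Longrightarrow> norm (V' n - W' n) \<le> e / 2"
    unfolding approximable_def by meson
  have "norm (V n + V' n - (W n + W' n)) \<le> e" if "n \<in> cube N" for n N
    using norm_diff_triangle_ineq[of "V n" "V' n" "W n" "W' n"] W(2,4)[OF that] by linarith
  with W(1,3) show "\<exists>W\<in>simple. \<forall>N. \<forall>n\<in>cube N. norm (V n + V' n - W n) \<le> e"
    by (intro bexI[of _ "\<lambda>n. W n + W' n"] simple_plus) auto
qed

text \<open>Choosing a nearby point of a finite net would give coefficients depending on
  \<open>n\<close> in an uncontrolled way. Projecting onto the span of the net instead gives matrix
  coefficients, whose products with \<open>\<phi>\<close> are good.\<close>

lemma approximable_compact:
  assumes \<phi>: "good \<phi>" and T: "T \<in> bounded_cops" and K: "compact K"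
    "\<And>N n. n \<in> cube N \<Longrightarrow> blinfun_apply T (E (L l n) y) \<in> K"
  shows "approximable (\<lambda>n. \<phi> n *\<^sub>C blinfun_apply T (E (L l n) y))"
  unfolding approximable_def
proof (intro allI impI)
  fix e :: real assume e: "e > 0"
  define v where "v n = blinfun_apply T (E (L l n) y)" for n
  obtain B where B: "\<And>n. norm (\<phi> n) \<le> B" using \<phi> by (auto simp: good_def)
  define d where "d = e / (\<bar>B\<bar> + 1)"
  have "d > 0" using e by (simp add: d_def add_nonneg_pos)
  then obtain Z where Z: "finite Z" "K \<subseteq> (\<Union>z\<in>Z. ball z d)"
    using K(1) unfolding compact_eq_totally_bounded by meson
  from Gram_Schmidt[OF Z(1)] obtain S where S: "finite S"
    "\<And>b b'. b \<in> S \<Longrightarrow> b' \<in> S \<Longrightarrow> cinner b b' = (if b = b' then 1 else 0)"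
    "\<And>z. z \<in> Z \<Longrightarrow> (\<Sum>b\<in>S. cinner z b *\<^sub>C b) = z" by auto
  let ?W = "\<lambda>n. \<Sum>b\<in>S. (\<phi> n * cinner (v n) b) *\<^sub>C b"
  have "?W \<in> simple"
    unfolding v_def by (intro simple_sum good_mult_correlation \<phi> T)
  moreover have "norm (\<phi> n *\<^sub>C v n - ?W n) \<le> e" if n: "n \<in> cube N" for n N
  proof -
    from K(2)[OF n] Z(2) obtain z where z: "z \<in> Z" "norm (v n - z) < d"
      by (auto simp: v_def dist_norm norm_minus_commute)
    \<comment> \<open>The projection reproduces \<open>z\<close>, so \<open>v n\<close> and
      \<open>v n - z\<close> have the same remainder, which is shorter than
      \<open>d\<close>.\<close>
    have eq: "v n - (\<Sum>b\<in>S. cinner (v n) b *\<^sub>C b)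
        = (v n - z) - (\<Sum>b\<in>S. cinner (v n - z) b *\<^sub>C b)"
      using S(3)[OF z(1)] by (simp add: cinner_diff_left scaleC_diff_left sum_subtractf)
    have "norm (v n - (\<Sum>b\<in>S. cinner (v n) b *\<^sub>C b)) \<le> norm (v n - z)"
      unfolding eq by (rule orthonormal_residual_le(1)[OF S(1,2)])
    then have "norm (v n - (\<Sum>b\<in>S. cinner (v n) b *\<^sub>C b)) \<le> d"
      using z(2) by linarith
    moreover have "\<phi> n *\<^sub>C v n - ?W n = \<phi> n *\<^sub>C (v n - (\<Sum>b\<in>S. cinner (v n) b *\<^sub>C b))"
      using scaleC_add_right[of "\<phi> n" "v n" "- (\<Sum>b\<in>S. cinner (v n) b *\<^sub>C b)"]
      by (simp add: scaleC_minus_right scaleC_sum_right scaleC_scaleC)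
    moreover have "norm (\<phi> n) \<le> \<bar>B\<bar> + 1" using B[of n] by linarith
    ultimately have "norm (\<phi> n *\<^sub>C v n - ?W n) \<le> (\<bar>B\<bar> + 1) * d"
      by (simp only: norm_scaleC) (intro mult_mono, auto)
    also have "\<dots> = e" by (simp add: d_def)
    finally show ?thesis .
  qed
  ultimately show "\<exists>W\<in>simple. \<forall>N. \<forall>n\<in>cube N. norm (\<phi> n *\<^sub>C blinfun_apply T (E (L l n) y) - W n) \<le> e"
    unfolding v_def[symmetric] by (intro bexI[of _ ?W]) auto
qed

text \<open>On a simple function the operator acts term by term and each term has its orbit in a
  compact set. The approximation error grows at most by the factor \<open>norm T\<close>, because
  powers of \<open>U\<close> are isometric.\<close>

lemma approximable_step:
  assumes V: "approximable V" and T: "T \<in> bounded_cops"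
    and K: "\<And>y. \<exists>K. compact K \<and> (\<forall>N. \<forall>n\<in>cube N. blinfun_apply T (E (L l n) y) \<in> K)"
  shows "approximable (\<lambda>n. blinfun_apply T (E (L l n) (V n)))"
proof -
  have E_add: "E m (x + y) = E m x + E m y" for m x y
    by (simp add: E_def blinfun.add_right)
  have step: "approximable (\<lambda>n. blinfun_apply T (E (L l n) (W n)))" if "W \<in> simple" for W
    using that
  proof (induction rule: simple.induct)
    case zero
    have "approximable (\<lambda>_. 0)"
      unfolding approximable_def by (intro allI impI bexI[of _ "\<lambda>_. 0"] simple.zero) auto
    then show ?case by (simp add: E_def blinfun.zero_right)
  next
    case (add W \<phi> y)
    obtain K where "compact K" "\<And>N n. n \<in> cube N \<Longrightarrow> blinfun_apply T (E (L l n) y) \<in> K"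
      using assms(3)[of y] by blast
    from approximable_add[OF add.IH approximable_compact[OF add.hyps(2) T this]]
    show ?case
      by (simp add: E_add E_scaleC blinfun.add_right bounded_cops_apply_scaleC T)
  qed
  show ?thesis
    unfolding approximable_def
  proof (intro allI impI)
    fix e :: real assume e: "e > 0"
    define d where "d = e / 2 / (norm T + 1)"
    have "d > 0" using e by (simp add: d_def add_nonneg_pos)
    then obtain W where W: "W \<in> simple" "\<And>N n. n \<in> cube N \<Longrightarrow> norm (V n - W n) \<le> d"
      using V unfolding approximable_def by meson
    have "e / 2 > 0" using e by simp
    then obtain W' where W': "W' \<in> simple"
      "\<And>N n. n \<in> cube N \<Longrightarrow> norm (blinfun_apply T (E (L l n) (W n)) - W' n) \<le> e / 2"
      using step[OF W(1)] unfolding approximable_def by meson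
    have "norm (blinfun_apply T (E (L l n) (V n)) - W' n) \<le> e" if n: "n \<in> cube N" for n N
    proof -
      have "blinfun_apply T (E (L l n) (V n)) - blinfun_apply T (E (L l n) (W n))
          = blinfun_apply T (E (L l n) (V n - W n))"
        by (simp add: E_def blinfun.diff_right)
      then have "norm (blinfun_apply T (E (L l n) (V n)) - blinfun_apply T (E (L l n) (W n)))
          \<le> norm T * norm (V n - W n)"
        using norm_blinfun[of T "E (L l n) (V n - W n)"] by simp
      also have "\<dots> \<le> (norm T + 1) * d"
        using W(2)[OF n] by (intro mult_mono) auto
      also have "\<dots> = e / 2"
      proof -
        have "c * (e / 2 / c) = e / 2" if "c > 0" for c :: real
          using that by simp
        then show ?thesis
          unfolding d_def by (simp only: add_nonneg_pos norm_ge_zero zero_less_one)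
      qed
      finally show ?thesis
        using W'(2)[OF n] norm_triangle_ineq[of "blinfun_apply T (E (L l n) (V n)) - blinfun_apply T (E (L l n) (W n))"
            "blinfun_apply T (E (L l n) (W n)) - W' n"] by simp
    qed
    with W'(1) show "\<exists>W\<in>simple. \<forall>N. \<forall>n\<in>cube N. norm (blinfun_apply T (E (L l n) (V n)) - W n) \<le> e"
      by blast
  qed
qed

lemma convergent_mean_approximable:
  assumes V: "approximable V"
  shows "convergent (mean (\<lambda>n. E (L l n) (V n)))"
proof (rule Cauchy_convergent, rule CauchyI)
  have simple: "convergent (mean (\<lambda>n. E (L l n) (W n)))" if "W \<in> simple" for W
    using that
  proof (induction rule: simple.induct)
    case zero
    then show ?case by (simp add: E_def blinfun.zero_right mean_def convergent_const)
  next
    case (add W \<phi> y)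
    have "mean (\<lambda>n. E (L l n) (W n + \<phi> n *\<^sub>C y))
        = (\<lambda>N. mean (\<lambda>n. E (L l n) (W n)) N + mean (\<lambda>n. \<phi> n *\<^sub>C E (L l n) y) N)"
      unfolding mean_add[symmetric] E_scaleC[symmetric] by (simp add: E_def blinfun.add_right fun_eq_iff)
    with convergent_add[OF add.IH convergent_mean_good_vector[OF add.hyps(2)]] show ?case by simp
  qed
  fix e :: real assume e: "e > 0"
  then have "e / 3 > 0" by simp
  then obtain W where W: "W \<in> simple" "\<And>N n. n \<in> cube N \<Longrightarrow> norm (V n - W n) \<le> e / 3"
    using V unfolding approximable_def by meson
  let ?X = "mean (\<lambda>n. E (L l n) (V n))" and ?Y = "mean (\<lambda>n. E (L l n) (W n))"
  have close: "norm (?X N - ?Y N) \<le> e / 3" for N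
  proof -
    have "?X N - ?Y N = mean (\<lambda>n. E (L l n) (V n - W n)) N"
      unfolding mean_diff[symmetric] by (simp add: E_def blinfun.diff_right)
    then show ?thesis
      using norm_mean_le[of N "\<lambda>n. E (L l n) (V n - W n)" "e / 3"] W(2) e by simp
  qed
  obtain M where M: "\<And>m n. m \<ge> M \<Longrightarrow> n \<ge> M \<Longrightarrow> norm (?Y m - ?Y n) < e / 3"
    using convergent_Cauchy[OF simple[OF W(1)]] \<open>e / 3 > 0\<close> unfolding Cauchy_iff by meson
  have "norm (?X m - ?X n) < e" if "m \<ge> M" "n \<ge> M" for m n
  proof -
    have eq: "?X m - ?X n = (?X m - ?Y m) + (?Y m - ?Y n) - (?X n - ?Y n)" by simp
    have "norm (?X m - ?X n) \<le> norm (?X m - ?Y m) + norm (?Y m - ?Y n) + norm (?X n - ?Y n)"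
      unfolding eq using norm_triangle_ineq4[of "(?X m - ?Y m) + (?Y m - ?Y n)" "?X n - ?Y n"]
        norm_triangle_ineq[of "?X m - ?Y m" "?Y m - ?Y n"] by linarith
    then show ?thesis using close[of m] close[of n] M[OF that] by linarith
  qed
  then show "\<exists>M. \<forall>m\<ge>M. \<forall>n\<ge>M. norm (?X m - ?X n) < e" by blast
qed

section \<open>Reduction of the operator product\<close>

lemma P_nonneg:
  assumes "p i \<in> nat_valued_polys" "i \<in> {1..r}" "n \<in> cube N"
  shows "P n i \<ge> 0"
proof -
  have "n i \<in> {1..N}" using assms(2,3) unfolding cube_def by (rule PiE_mem[rotated])
  with assms(1) show ?thesis by (simp add: nat_valued_polys_def P_def)
qed

lemma L_single: "i \<in> {1..r} \<Longrightarrow> L (\<lambda>i'. if i' = i then 1 else 0) n = P n i"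
  by (simp add: L_def if_distrib[of "\<lambda>x. x * _"] sum.delta cong: if_cong)

text \<open>The induction removes the rightmost factor: \<open>A (Suc m)\<close> with the power of
  \<open>U\<close> on its right is absorbed into the vector, and the power on its left becomes the
  new outer one, which is why \<open>V\<close> and \<open>i\<close> vary. Keeping that power outside
  \<open>V\<close> leaves it adjacent to the next \<open>A j\<close>, where the compactness
  hypothesis needs it.\<close>

lemma convergent_mean_op_prod:
  assumes "\<And>i. i \<in> {1..r} \<Longrightarrow> p i \<in> nat_valued_polys"
    and "\<alpha> ` {1..m} \<subseteq> {1..r}"
    and "\<And>j. j \<in> {1..m} \<Longrightarrow> A j \<in> bounded_cops"
    and "\<And>j y. j \<in> {1..m} \<Longrightarrow> \<exists>K. compact K \<and> (\<forall>q\<ge>0. blinfun_apply (A j) (E q y) \<in> K)"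
    and "approximable V" "i \<in> {1..r}"
  shows "convergent (mean (\<lambda>n. blinfun_apply (op_prod (\<lambda>j. op_powi U (P n (\<alpha> j)) o\<^sub>L A j) m)
    (E (P n i) (V n))))"
  using assms(2-)
proof (induction m arbitrary: V i)
  case 0
  then show ?case using convergent_mean_approximable[of V "\<lambda>i'. if i' = i then 1 else 0"]
    by (simp add: L_single)
next
  case (Suc m)
  have nonneg: "P n i \<ge> 0" if "n \<in> cube N" for n N
    using that assms(1) Suc.prems(5) by (blast intro: P_nonneg)
  have "approximable (\<lambda>n. blinfun_apply (A (Suc m)) (E (L (\<lambda>i'. if i' = i then 1 else 0) n) (V n)))"
  proof (intro approximable_step Suc.prems)
    fix y
    obtain K where "compact K" "\<forall>q\<ge>0. blinfun_apply (A (Suc m)) (E q y) \<in> K"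
      using Suc.prems(3)[of "Suc m" y] by auto
    then show "\<exists>K. compact K \<and> (\<forall>N. \<forall>n\<in>cube N.
        blinfun_apply (A (Suc m)) (E (L (\<lambda>i'. if i' = i then 1 else 0) n) y) \<in> K)"
      using nonneg Suc.prems(5) by (auto simp: L_single)
  qed auto
  then have "convergent (mean (\<lambda>n. blinfun_apply (op_prod (\<lambda>j. op_powi U (P n (\<alpha> j)) o\<^sub>L A j) m)
    (E (P n (\<alpha> (Suc m))) (blinfun_apply (A (Suc m)) (E (P n i) (V n))))))"
    using Suc.prems by (intro Suc.IH) (auto simp: L_single image_subset_iff)
  then show ?case by (simp add: E_def)
qed

end

section \<open>The strong operator topology\<close>

text \<open>The topology is pulled back from the product topology along
  \<open>blinfun_apply\<close>, so coordinatewise limits suffice.\<close>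

lemma limitin_strong_operator_topology:
  assumes "\<And>x. ((\<lambda>i. blinfun_apply (f i) x) \<longlongrightarrow> blinfun_apply l x) F"
  shows "limitin strong_operator_topology f l F"
  unfolding limitin_def strong_operator_topology_def
proof (intro conjI allI impI)
  have lim: "limitin (product_topology (\<lambda>_. euclidean) UNIV) (\<lambda>i. blinfun_apply (f i)) (blinfun_apply l) F"
    using assms by (simp add: limitin_componentwise)
  fix W assume "openin (pullback_topology UNIV blinfun_apply euclidean) W \<and> l \<in> W"
  then obtain V where V: "open V" "W = blinfun_apply -` V" "l \<in> W"
    unfolding openin_pullback_topology by auto
  then show "\<forall>\<^sub>F i in F. f i \<in> W"
    using lim unfolding euclidean_product_topology by (auto simp: tendsto_def)
qed (simp add: topspace_pullback_topology)

text \<open>The uniform bound makes the pointwise limit a bounded operator. It must also be complex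
  linear, since the topology is restricted to \<open>bounded_cops\<close>.\<close>

lemma sot_pointwise_limit:
  fixes f :: "nat \<Rightarrow> ('h::chilbert_space \<Rightarrow>\<^sub>L 'h)"
  assumes cops: "\<And>N. f N \<in> bounded_cops" and bound: "\<And>N. norm (f N) \<le> C"
    and conv: "\<And>x. convergent (\<lambda>N. blinfun_apply (f N) x)"
  shows "\<exists>l. limitin sot f l sequentially"
proof -
  define g where "g x = lim (\<lambda>N. blinfun_apply (f N) x)" for x
  have g: "(\<lambda>N. blinfun_apply (f N) x) \<longlonglongrightarrow> g x" for x
    using conv[of x] by (simp add: g_def convergent_LIMSEQ_iff)
  have "bounded_linear g"
  proof
    show "g (x + y) = g x + g y" for x y
      by (rule LIMSEQ_unique[OF g]) (simp add: blinfun.add_right tendsto_add g)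
    show "g (c *\<^sub>R x) = c *\<^sub>R g x" for c x
      by (rule LIMSEQ_unique[OF g]) (simp add: blinfun.scaleR_right tendsto_scaleR g)
    have "norm (g x) \<le> norm x * C" for x
    proof (rule LIMSEQ_le_const2[OF tendsto_norm[OF g]], intro exI allI impI)
      show "norm (blinfun_apply (f N) x) \<le> norm x * C" for N
        using norm_blinfun[of "f N" x] mult_right_mono[OF bound[of N], of "norm x"]
        by (simp add: mult.commute)
    qed
    then show "\<exists>K. \<forall>x. norm (g x) \<le> norm x * K" by blast
  qed
  then have Blinfun_g: "blinfun_apply (Blinfun g) = g" by (rule bounded_linear_Blinfun_apply)
  have "g (c *\<^sub>C x) = c *\<^sub>C g x" for c x
  proof (rule LIMSEQ_unique[OF g])
    have "norm (c *\<^sub>C z - c *\<^sub>C w) = norm c * norm (z - w)" for z w :: 'h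
      using norm_scaleC[of c "z - w"] scaleC_add_right[of c z "- w"] by (simp add: scaleC_minus_right)
    moreover have "(\<lambda>N. norm c * norm (blinfun_apply (f N) x - g x)) \<longlonglongrightarrow> norm c * 0"
      using g[of x] by (intro tendsto_mult_left) (simp add: tendsto_norm_zero_iff LIM_zero)
    ultimately have "(\<lambda>N. c *\<^sub>C blinfun_apply (f N) x) \<longlonglongrightarrow> c *\<^sub>C g x"
      by (simp add: tendsto_iff dist_norm)
    then show "(\<lambda>N. blinfun_apply (f N) (c *\<^sub>C x)) \<longlonglongrightarrow> c *\<^sub>C g x"
      by (simp add: bounded_cops_apply_scaleC[OF cops])
  qed
  then have "Blinfun g \<in> bounded_cops" by (simp add: bounded_cops_def Blinfun_g)
  then show ?thesis
    unfolding sot_def limitin_subtopology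
    using cops g by (intro exI[of _ "Blinfun g"]) (auto simp: Blinfun_g intro: limitin_strong_operator_topology)
qed

lemma norm_op_prod_le: "norm (op_prod B k) \<le> (\<Prod>j=1..k. norm (B j))"
proof (induction k)
  case 0
  then show ?case by (simp add: norm_blinfun_id_le)
next
  case (Suc k)
  have "norm (op_prod B (Suc k)) \<le> norm (op_prod B k) * norm (B (Suc k))"
    by (simp add: norm_blinfun_compose)
  also have "\<dots> \<le> (\<Prod>j=1..k. norm (B j)) * norm (B (Suc k))"
    by (intro mult_right_mono Suc) auto
  finally show ?case by (simp add: prod.nat_ivl_Suc')
qed

lemma op_prod_bounded_cops:
  "(\<And>j. j \<in> {1..k} \<Longrightarrow> B j \<in> bounded_cops) \<Longrightarrow> op_prod B k \<in> bounded_cops"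
  by (induction k) (auto intro: bounded_cops_id bounded_cops_compose)

text \<open>Evaluation at \<open>y\<close> is continuous into the norm topology, so the image of the
  compact closure is norm compact.\<close>

lemma relatively_compact_orbit:
  assumes "relatively_compactin sot S"
  obtains K where "compact K" "\<And>T. T \<in> S \<Longrightarrow> blinfun_apply T y \<in> K"
proof -
  have "continuous_map sot euclidean (\<lambda>T. blinfun_apply T y)"
    unfolding sot_def
    by (intro continuous_map_from_subtopology strong_operator_topology_continuous_evaluation)
  then have "compactin euclidean ((\<lambda>T. blinfun_apply T y) ` (sot closure_of S))"
    using assms image_compactin unfolding relatively_compactin_def by blast
  moreover have "S \<subseteq> sot closure_of S"
    using assms by (simp add: relatively_compactin_def closure_of_subset)
  ultimately show ?thesis by (intro that) auto
qed

theorem proposition3p3: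
  fixes U :: "'h::chilbert_space \<Rightarrow>\<^sub>L 'h"
    and r k :: nat
    and p :: "nat \<Rightarrow> int poly"
    and \<alpha> :: "nat \<Rightarrow> nat"
    and A :: "nat \<Rightarrow> ('h \<Rightarrow>\<^sub>L 'h)"
  assumes "unitary_op U"
    and "r \<ge> 1" and "k \<ge> 1"
    and "\<And>i. i \<in> {1..r} \<Longrightarrow> p i \<in> nat_valued_polys"
    and "\<alpha> ` {1..k} = {1..r}"
    and "\<And>j. j \<in> {1..k} \<Longrightarrow> A j \<in> bounded_cops"
    and "relatively_compactin sot {A k o\<^sub>L op_powi U (- int n) |n::nat. n \<ge> 1}"
    and "\<And>j. j \<in> {1..k - 1} \<Longrightarrow> relatively_compactin sot {A j o\<^sub>L op_powi U (int n) |n::nat. n \<ge> 1}"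
  shows "\<exists>L. limitin sot (\<lambda>N. entangled_average U r k p \<alpha> A N) L sequentially"
proof (rule sot_pointwise_limit)
  interpret polynomial_averages U r p
    by (intro polynomial_averages.intro unitary_operator.intro assms)
  define S where "S n = (\<Sum>j=1..k. P n (\<alpha> j))" for n
  define D where "D n = op_prod (\<lambda>j. op_powi U (P n (\<alpha> j)) o\<^sub>L A j) k o\<^sub>L op_powi U (- S n)" for n
  have avg: "entangled_average U r k p \<alpha> A N = mean D N" for N
    by (simp add: entangled_average_def mean_def D_def S_def cube_def P_def)
  have norm_U: "norm (op_powi U m) \<le> 1" for m
    using norm_E by (intro norm_blinfun_bound) (auto simp: E_def)
  show "entangled_average U r k p \<alpha> A N \<in> bounded_cops" for N
    unfolding avg mean_def D_def
    by (intro bounded_cops_scaleR bounded_cops_sum bounded_cops_compose op_prod_bounded_cops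
        op_powi_bounded_cops assms(6))
  show "norm (entangled_average U r k p \<alpha> A N) \<le> (\<Prod>j=1..k. norm (A j))" for N
    unfolding avg
  proof (rule norm_mean_le)
    fix n
    have "norm (op_powi U m o\<^sub>L A j) \<le> norm (A j)" for m j
      using norm_blinfun_compose[of "op_powi U m" "A j"]
        mult_right_mono[OF norm_U[of m], of "norm (A j)"] by simp
    then have "(\<Prod>j=1..k. norm (op_powi U (P n (\<alpha> j)) o\<^sub>L A j)) \<le> (\<Prod>j=1..k. norm (A j))"
      by (intro prod_mono) auto
    then have "norm (op_prod (\<lambda>j. op_powi U (P n (\<alpha> j)) o\<^sub>L A j) k) \<le> (\<Prod>j=1..k. norm (A j))"
      by (rule order_trans[OF norm_op_prod_le])
    then have "norm (op_prod (\<lambda>j. op_powi U (P n (\<alpha> j)) o\<^sub>L A j) k) * norm (op_powi U (- S n))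
        \<le> (\<Prod>j=1..k. norm (A j)) * 1"
      by (intro mult_mono norm_U prod_nonneg) auto
    then show "norm (D n) \<le> (\<Prod>j=1..k. norm (A j))"
      unfolding D_def mult_1_right by (rule order_trans[OF norm_blinfun_compose])
  qed (simp add: prod_nonneg)
  fix x
  obtain k' where k: "k = Suc k'" using assms(3) by (cases k) auto
  have \<alpha>: "\<alpha> j \<in> {1..r}" if "j \<in> {1..k}" for j using assms(5) that by blast
  have nonneg: "S n \<ge> 0" if "n \<in> cube N" for n N
    unfolding S_def
  proof (rule sum_nonneg)
    fix j assume "j \<in> {1..k}"
    with \<alpha> that assms(4) show "P n (\<alpha> j) \<ge> 0" by (blast intro: P_nonneg)
  qed
  \<comment> \<open>Minus the number of positions \<open>j\<close> with
    \<open>\<alpha> j = i\<close>: a polynomial used several times contributes with that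
    multiplicity to \<open>S n\<close>.\<close>
  define l where "l i = - (\<Sum>j=1..k. if i = \<alpha> j then 1 else 0 :: int)" for i
  have L: "L l n = - S n" for n
  proof -
    have "L l n = - (\<Sum>j=1..k. L (\<lambda>i. if i = \<alpha> j then 1 else 0) n)"
      by (simp add: L_def l_def sum_distrib_right sum_negf) (rule sum.swap)
    also have "\<dots> = - S n"
      unfolding S_def using L_single[OF \<alpha>] by simp
    finally show ?thesis .
  qed
  (* p i may vanish, but the orbits only cover exponents q >= 1: write U^(-q) x as U^(-(q+1)) (U x),
     and U^q y as U^(q+1) (U^(-1) y) below. *)
  obtain K where K: "compact K"
    "\<And>T. T \<in> {A k o\<^sub>L op_powi U (- int n) |n::nat. n \<ge> 1} \<Longrightarrow> blinfun_apply T (E 1 x) \<in> K"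
    by (rule relatively_compact_orbit[OF assms(7), of "E 1 x"]) blast
  have orbit: "blinfun_apply (A k) (E (- int q) (E 1 x)) \<in> K" if "q \<ge> 1" for q
    using K(2)[of "A k o\<^sub>L op_powi U (- int q)"] that by (auto simp: E_def)
  \<comment> \<open>The factor \<open>A k\<close> is treated apart from the others because the power
    on its right is negative. The constant scalar 1 starts the chain of good functions.\<close>
  have "approximable (\<lambda>n. 1 *\<^sub>C blinfun_apply (A k) (E (L l n) x))"
  proof (rule approximable_compact[OF good_one _ K(1)])
    show "A k \<in> bounded_cops" using assms(3,6) by simp
    fix N n assume n: "n \<in> cube N"
    have "E (- S n) x = E (- int (nat (S n + 1))) (E 1 x)"
      using nonneg[OF n] by (simp flip: E_add)
    then show "blinfun_apply (A k) (E (L l n) x) \<in> K"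
      using orbit[of "nat (S n + 1)"] nonneg[OF n] unfolding L by simp
  qed
  then have "convergent (mean (\<lambda>n. blinfun_apply (op_prod (\<lambda>j. op_powi U (P n (\<alpha> j)) o\<^sub>L A j) k')
    (E (P n (\<alpha> k)) (1 *\<^sub>C blinfun_apply (A k) (E (L l n) x)))))"
  proof (intro convergent_mean_op_prod assms(4))
    fix j y assume j: "j \<in> {1..k'}"
    then have "j \<in> {1..k - 1}" by (simp add: k)
    then obtain K where K: "compact K"
      "\<And>T. T \<in> {A j o\<^sub>L op_powi U (int n) |n::nat. n \<ge> 1} \<Longrightarrow> blinfun_apply T (E (- 1) y) \<in> K"
      by (rule relatively_compact_orbit[OF assms(8), of j "E (- 1) y"]) blast+
    have orbit: "blinfun_apply (A j) (E (int q) (E (- 1) y)) \<in> K" if "q \<ge> 1" for q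
      using K(2)[of "A j o\<^sub>L op_powi U (int q)"] that by (auto simp: E_def)
    have "blinfun_apply (A j) (E q y) \<in> K" if "q \<ge> 0" for q
    proof -
      have "E q y = E (int (nat (q + 1))) (E (- 1) y)"
        using that by (simp flip: E_add)
      then show ?thesis
        using orbit[of "nat (q + 1)"] that by simp
    qed
    with K(1) show "\<exists>K. compact K \<and> (\<forall>q\<ge>0. blinfun_apply (A j) (E q y) \<in> K)" by blast
  qed (use assms(3,5,6) \<alpha> k in auto)
  moreover have "blinfun_apply (mean D N) x = mean (\<lambda>n. blinfun_apply (D n) x) N" for N
    by (rule linear_mean) (intro bounded_linear.linear blinfun.bounded_linear_left)
  ultimately show "convergent (\<lambda>N. blinfun_apply (entangled_average U r k p \<alpha> A N) x)"
    unfolding avg by (simp add: D_def k E_def L)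
qed

end
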